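(* There exists a bounded linear operator $T$ on the complex Hilbert space $\ell^2$ such that $T$ is mixing and chaotic and the pair $(T,T^2)$ is not $d$-transitive.
   Context: For a bounded linear operator $T$ on $X$ and non-empty open sets $U,V\subseteq X$, let $N(U,V)=\{n\ge 0: T^n(U)\cap V\ne\emptyset\}$. $T$ is mixing if $N(U,V)$ is cofinite for all non-empty open $U,V$. $T$ is hypercyclic if some vector $x$ has dense orbit $\{T^nx:n\ge 0\}$. A point $x$ is periodic for $T$ if $T^kx=x$ for some $k\ge 1$. $T$ is chaotic if it is hypercyclic and its set of periodic points is dense. A tuple of operators $(T_1,\dots,T_N)$ on $X$ is $d$-transitive (disjoint transitive) if for all non-empty open sets $U_0,U_1,\dots,U_N\subseteq X$ the set $\{k\ge 0: T_1^{-k}(U_1)\cap\dots\cap T_N^{-k}(U_N)\cap U_0\ne\emptyset\}$ is non-empty. *)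

theory Defs
  imports "HOL-Analysis.Analysis"
begin

section \<open>The complex Hilbert space of square-summable sequences\<close>

definition square_summable :: "(nat \<Rightarrow> complex) \<Rightarrow> bool" where
  "square_summable x \<longleftrightarrow> summable (\<lambda>n. (cmod (x n))\<^sup>2)"

lemma square_summable_0: "square_summable (\<lambda>n. 0)"
  by (simp add: square_summable_def)

lemma square_summable_add:
  assumes "square_summable x" "square_summable y"
  shows "square_summable (\<lambda>n. x n + y n)"
proof -
  have bound: "(cmod (x n + y n))\<^sup>2 \<le> 2 * (cmod (x n))\<^sup>2 + 2 * (cmod (y n))\<^sup>2" for n
  proof -
    have "(cmod (x n + y n))\<^sup>2 \<le> (cmod (x n) + cmod (y n))\<^sup>2"
      by (intro power_mono norm_triangle_ineq norm_ge_zero)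
    also have "\<dots> \<le> 2 * (cmod (x n))\<^sup>2 + 2 * (cmod (y n))\<^sup>2"
      using zero_le_power2[of "cmod (x n) - cmod (y n)"]
      by (simp add: power2_sum power2_diff)
    finally show ?thesis .
  qed
  have "summable (\<lambda>n. 2 * (cmod (x n))\<^sup>2 + 2 * (cmod (y n))\<^sup>2)"
    using assms unfolding square_summable_def by (intro summable_add summable_mult)
  then show ?thesis
    unfolding square_summable_def
    by (rule summable_comparison_test') (use bound in auto)
qed

lemma square_summable_mult:
  assumes "square_summable x"
  shows "square_summable (\<lambda>n. c * x n)"
  using assms unfolding square_summable_def
  by (simp add: norm_mult power_mult_distrib summable_mult)

lemma square_summable_minus:
  "square_summable x \<Longrightarrow> square_summable (\<lambda>n. - x n)"
  by (simp add: square_summable_def)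

lemma square_summable_diff:
  "square_summable x \<Longrightarrow> square_summable y \<Longrightarrow> square_summable (\<lambda>n. x n - y n)"
  using square_summable_add[OF _ square_summable_minus, of x y] by simp

lemma square_summable_inner:
  assumes "square_summable x" "square_summable y"
  shows "summable (\<lambda>n. x n * cnj (y n))"
proof -
  have bound: "cmod (x n * cnj (y n)) \<le> (cmod (x n))\<^sup>2 + (cmod (y n))\<^sup>2" for n
  proof -
    have "2 * (cmod (x n) * cmod (y n)) \<le> (cmod (x n))\<^sup>2 + (cmod (y n))\<^sup>2"
      using zero_le_power2[of "cmod (x n) - cmod (y n)"] by (simp add: power2_diff)
    moreover have "0 \<le> cmod (x n) * cmod (y n)" by simp
    ultimately show ?thesis unfolding norm_mult complex_mod_cnj by linarith
  qed
  have "summable (\<lambda>n. (cmod (x n))\<^sup>2 + (cmod (y n))\<^sup>2)"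
    using assms unfolding square_summable_def by (intro summable_add)
  then show ?thesis
    by (rule summable_comparison_test') (use bound in auto)
qed

typedef ell2 = "{x :: nat \<Rightarrow> complex. square_summable x}"
  morphisms coord Abs_ell2
  using square_summable_0 by blast

setup_lifting type_definition_ell2

lemma square_summable_coord: "square_summable (coord x)"
  using coord[of x] by simp

instantiation ell2 :: real_vector
begin

lift_definition zero_ell2 :: ell2 is "\<lambda>n. 0"
  by (rule square_summable_0)

lift_definition plus_ell2 :: "ell2 \<Rightarrow> ell2 \<Rightarrow> ell2" is "\<lambda>x y n. x n + y n"
  by (rule square_summable_add)

lift_definition uminus_ell2 :: "ell2 \<Rightarrow> ell2" is "\<lambda>x n. - x n"
  by (rule square_summable_minus)

lift_definition minus_ell2 :: "ell2 \<Rightarrow> ell2 \<Rightarrow> ell2" is "\<lambda>x y n. x n - y n"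
  by (rule square_summable_diff)

lift_definition scaleR_ell2 :: "real \<Rightarrow> ell2 \<Rightarrow> ell2" is "\<lambda>r x n. complex_of_real r * x n"
  by (rule square_summable_mult)

instance
  by standard (transfer; simp add: fun_eq_iff algebra_simps)+

end

lift_definition cscale :: "complex \<Rightarrow> ell2 \<Rightarrow> ell2" (infixr "*\<^sub>C" 75) is "\<lambda>c x n. c * x n"
  by (rule square_summable_mult)

lemma scaleR_eq_cscale: "r *\<^sub>R x = complex_of_real r *\<^sub>C x" for x :: ell2
  by transfer simp

interpretation ell2: vector_space cscale
  by standard (transfer; simp add: fun_eq_iff algebra_simps)+

definition cinner :: "ell2 \<Rightarrow> ell2 \<Rightarrow> complex" where
  "cinner x y = (\<Sum>n. coord x n * cnj (coord y n))"

text \<open>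
  The norm and topology are those of the complex inner product; the library's
  class of inner product spaces is real, so it is instantiated with the real part.
\<close>

instantiation ell2 :: real_inner
begin

definition inner_ell2 :: "ell2 \<Rightarrow> ell2 \<Rightarrow> real" where
  "inner_ell2 x y = Re (cinner x y)"

definition norm_ell2 :: "ell2 \<Rightarrow> real" where
  "norm_ell2 x = sqrt (\<Sum>n. (cmod (coord x n))\<^sup>2)"

definition sgn_ell2 :: "ell2 \<Rightarrow> ell2" where
  "sgn_ell2 x = x /\<^sub>R norm x"

definition dist_ell2 :: "ell2 \<Rightarrow> ell2 \<Rightarrow> real" where
  "dist_ell2 x y = norm (x - y)"

definition uniformity_ell2 :: "(ell2 \<times> ell2) filter" where
  "uniformity_ell2 = (INF e\<in>{0 <..}. principal {(x, y). dist x y < e})"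

definition open_ell2 :: "ell2 set \<Rightarrow> bool" where
  "open_ell2 U \<longleftrightarrow> (\<forall>x\<in>U. eventually (\<lambda>(x', y). x' = x \<longrightarrow> y \<in> U) uniformity)"

lemma inner_ell2_sums: "(\<lambda>n. Re (coord x n * cnj (coord y n))) sums inner x y"
  unfolding inner_ell2_def cinner_def
  by (intro sums_Re summable_sums square_summable_inner square_summable_coord)

lemma inner_ell2_self: "inner x x = (\<Sum>n. (cmod (coord x n))\<^sup>2)" for x :: ell2
  using sums_unique[OF inner_ell2_sums[of x x]]
  by (simp only: complex_norm_square[symmetric] Re_complex_of_real)

instance
proof
  fix x y z :: ell2 and r :: real
  show "inner x y = inner y x"
    by (rule sums_unique2[OF inner_ell2_sums])
      (use inner_ell2_sums[of y x] in \<open>simp add: mult.commute\<close>)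
  show "inner (x + y) z = inner x z + inner y z"
    by (rule sums_unique2[OF inner_ell2_sums])
      (use sums_add[OF inner_ell2_sums[of x z] inner_ell2_sums[of y z]]
        in \<open>simp add: plus_ell2.rep_eq algebra_simps\<close>)
  show "inner (r *\<^sub>R x) y = r * inner x y"
    by (rule sums_unique2[OF inner_ell2_sums])
      (use sums_mult[OF inner_ell2_sums[of x y], of r]
        in \<open>simp add: scaleR_ell2.rep_eq algebra_simps\<close>)
  have s: "summable (\<lambda>n. (cmod (coord x n))\<^sup>2)"
    using square_summable_coord unfolding square_summable_def .
  show "0 \<le> inner x x"
    unfolding inner_ell2_self by (rule suminf_nonneg[OF s]) simp
  show "inner x x = 0 \<longleftrightarrow> x = 0"
    unfolding inner_ell2_self suminf_eq_zero_iff[OF s zero_le_power2]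
    by transfer (auto simp: fun_eq_iff)
  show "norm x = sqrt (inner x x)"
    by (simp add: norm_ell2_def inner_ell2_self)
qed (simp_all add: dist_ell2_def sgn_ell2_def uniformity_ell2_def open_ell2_def)

end

lemma norm_ell2_power2: "(norm x)\<^sup>2 = (\<Sum>n. (cmod (coord x n))\<^sup>2)" for x :: ell2
  by (simp only: power2_norm_eq_inner inner_ell2_self)

lemma cinner_self: "cinner x x = complex_of_real ((norm x)\<^sup>2)"
proof -
  have "(\<lambda>n. complex_of_real ((cmod (coord x n))\<^sup>2)) sums complex_of_real ((norm x)\<^sup>2)"
    using square_summable_coord[of x] unfolding square_summable_def
    by (intro sums_of_real) (simp add: norm_ell2_power2 summable_sums)
  then show ?thesis
    unfolding cinner_def complex_norm_square by (simp add: sums_iff)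
qed

lemma coord_diff: "coord (x - y) n = coord x n - coord y n"
  by (simp add: minus_ell2.rep_eq)

lemma sum_coord_le_norm: "(\<Sum>n<M. (cmod (coord x n))\<^sup>2) \<le> (norm x)\<^sup>2"
  using square_summable_coord[of x] unfolding square_summable_def norm_ell2_power2
  by (intro sum_le_suminf) auto

lemma cmod_coord_le_norm: "cmod (coord x n) \<le> norm x"
proof -
  have "(cmod (coord x n))\<^sup>2 \<le> (\<Sum>k<Suc n. (cmod (coord x k))\<^sup>2)"
    by (intro member_le_sum) auto
  then have "(cmod (coord x n))\<^sup>2 \<le> (norm x)\<^sup>2"
    using sum_coord_le_norm order_trans by blast
  then show ?thesis
    by (rule power2_le_imp_le) simp
qed

instance ell2 :: banach
proof
  fix X :: "nat \<Rightarrow> ell2"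
  assume X: "Cauchy X"
  have "Cauchy (\<lambda>k. coord (X k) n)" for n
  proof (rule metric_CauchyI)
    fix e :: real assume "0 < e"
    then obtain N where "\<forall>m\<ge>N. \<forall>k\<ge>N. dist (X m) (X k) < e"
      using X metric_CauchyD by blast
    then show "\<exists>N. \<forall>m\<ge>N. \<forall>k\<ge>N. dist (coord (X m) n) (coord (X k) n) < e"
      using cmod_coord_le_norm[of "X m - X k" n for m k]
      by (metis coord_diff dist_norm order_le_less_trans)
  qed
  then have "\<exists>a. (\<lambda>k. coord (X k) n) \<longlonglongrightarrow> a" for n
    by (simp add: Cauchy_convergent_iff convergent_def)
  then obtain a where a: "\<And>n. (\<lambda>k. coord (X k) n) \<longlonglongrightarrow> a n"
    by metis
  have tail: "\<exists>N. \<forall>m\<ge>N. \<forall>M. (\<Sum>n<M. (cmod (coord (X m) n - a n))\<^sup>2) \<le> e\<^sup>2"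
    if "0 < e" for e :: real
  proof -
    obtain N where N: "\<And>m k. m \<ge> N \<Longrightarrow> k \<ge> N \<Longrightarrow> dist (X m) (X k) < e"
      using X metric_CauchyD \<open>0 < e\<close> by blast
    have "(\<Sum>n<M. (cmod (coord (X m) n - a n))\<^sup>2) \<le> e\<^sup>2" if "m \<ge> N" for m M
    proof (rule tendsto_upperbound)
      show "(\<lambda>k. \<Sum>n<M. (cmod (coord (X m) n - coord (X k) n))\<^sup>2)
          \<longlonglongrightarrow> (\<Sum>n<M. (cmod (coord (X m) n - a n))\<^sup>2)"
        by (intro tendsto_intros a)
      show "\<forall>\<^sub>F k in sequentially. (\<Sum>n<M. (cmod (coord (X m) n - coord (X k) n))\<^sup>2) \<le> e\<^sup>2"
      proof (rule eventually_sequentiallyI)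
        fix k assume "N \<le> k"
        have "(\<Sum>n<M. (cmod (coord (X m) n - coord (X k) n))\<^sup>2) \<le> (norm (X m - X k))\<^sup>2"
          using sum_coord_le_norm[of "X m - X k" M] by (simp add: coord_diff)
        also have "\<dots> \<le> e\<^sup>2"
          using N[OF that \<open>N \<le> k\<close>] by (intro power_mono) (auto simp: dist_norm)
        finally show "(\<Sum>n<M. (cmod (coord (X m) n - coord (X k) n))\<^sup>2) \<le> e\<^sup>2" .
      qed
    qed simp
    then show ?thesis by blast
  qed
  have diff: "square_summable (\<lambda>n. coord (X m) n - a n)"
    if "\<forall>M. (\<Sum>n<M. (cmod (coord (X m) n - a n))\<^sup>2) \<le> e\<^sup>2" for m e
    unfolding square_summable_def using that by (intro summableI_nonneg_bounded) auto
  obtain m where "square_summable (\<lambda>n. coord (X m) n - a n)"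
    using tail[of 1] diff[of _ 1] by auto
  from square_summable_diff[OF square_summable_coord[of "X m"] this]
  have "square_summable a" by simp
  then have coord_a: "coord (Abs_ell2 a) = a"
    by (simp add: Abs_ell2_inverse)
  have "X \<longlonglongrightarrow> Abs_ell2 a"
  proof (rule metric_LIMSEQ_I)
    fix e :: real assume "0 < e"
    obtain N where N: "\<And>m M. m \<ge> N \<Longrightarrow> (\<Sum>n<M. (cmod (coord (X m) n - a n))\<^sup>2) \<le> (e / 2)\<^sup>2"
      using tail[of "e / 2"] \<open>0 < e\<close> by auto
    have "dist (X m) (Abs_ell2 a) < e" if "m \<ge> N" for m
    proof -
      have "(norm (X m - Abs_ell2 a))\<^sup>2 \<le> (e / 2)\<^sup>2"
        unfolding norm_ell2_power2 coord_diff coord_a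
        using diff[of m "e / 2"] N[OF that] unfolding square_summable_def
        by (intro suminf_le_const) auto
      then have "norm (X m - Abs_ell2 a) \<le> e / 2"
        by (rule power2_le_imp_le) (use \<open>0 < e\<close> in simp)
      then show ?thesis
        using \<open>0 < e\<close> by (simp add: dist_norm)
    qed
    then show "\<exists>N. \<forall>m\<ge>N. dist (X m) (Abs_ell2 a) < e" by blast
  qed
  then show "convergent X"
    by (rule convergentI)
qed

text \<open>
  \<^const>\<open>bounded_linear\<close> only gives real linearity, hence the additional
  requirement of linearity over the complex numbers.
\<close>

definition bounded_clinear :: "(ell2 \<Rightarrow> ell2) \<Rightarrow> bool" where
  "bounded_clinear T \<longleftrightarrow> bounded_linear T \<and> Vector_Spaces.linear cscale cscale T"


section \<open>Dynamics of iterates\<close>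

definition return_set :: "('a \<Rightarrow> 'a) \<Rightarrow> 'a set \<Rightarrow> 'a set \<Rightarrow> nat set" where
  "return_set T U V = {n. (T ^^ n) ` U \<inter> V \<noteq> {}}"

definition mixing :: "('a::topological_space \<Rightarrow> 'a) \<Rightarrow> bool" where
  "mixing T \<longleftrightarrow> (\<forall>U V. open U \<and> U \<noteq> {} \<and> open V \<and> V \<noteq> {} \<longrightarrow> finite (- return_set T U V))"

definition hypercyclic :: "('a::topological_space \<Rightarrow> 'a) \<Rightarrow> bool" where
  "hypercyclic T \<longleftrightarrow> (\<exists>x. closure {(T ^^ n) x | n. True} = UNIV)"

definition periodic_point :: "('a \<Rightarrow> 'a) \<Rightarrow> 'a \<Rightarrow> bool" where
  "periodic_point T x \<longleftrightarrow> (\<exists>k\<ge>1. (T ^^ k) x = x)"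

definition chaotic :: "('a::topological_space \<Rightarrow> 'a) \<Rightarrow> bool" where
  "chaotic T \<longleftrightarrow> hypercyclic T \<and> closure {x. periodic_point T x} = UNIV"

text \<open>
  The tuple of operators is a list; \<open>Ts ! i\<close> and \<open>Us ! i\<close> are the mathematical
  $T_{i+1}$ and $U_{i+1}$.
\<close>

definition d_transitive :: "('a::topological_space \<Rightarrow> 'a) list \<Rightarrow> bool" where
  "d_transitive Ts \<longleftrightarrow>
    (\<forall>U0 Us. open U0 \<and> U0 \<noteq> {} \<and> length Us = length Ts \<and> (\<forall>U\<in>set Us. open U \<and> U \<noteq> {}) \<longrightarrow>
      {k. (\<Inter>i<length Ts. ((Ts ! i) ^^ k) -` (Us ! i)) \<inter> U0 \<noteq> {}} \<noteq> {})"

end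

theory Submission
  imports Defs "HOL-Real_Asymp.Real_Asymp"
begin

text \<open>
  The operator has a linearly dense family of periodic vectors \<open>orb m i\<close>, permuted by
  \<open>op_T (orb m i) = orb m (i + 1)\<close>. With \<open>m\<close> coding \<open>(k, l)\<close>, \<open>orb m i\<close> is a multiple \<open>size_at m i\<close> of an own basis
  vector plus, for \<open>i\<close> near \<open>k\<close>, the vector \<open>orb l (i - k)\<close>. The sizes are small only near \<open>i = 0\<close> and \<open>i = k\<close>,
  so \<open>orb m 0\<close> is small and its \<open>k\<close>-th iterate is close to \<open>orb l 0\<close>. Since \<open>l\<close> and all large \<open>k\<close> are arbitrary,
  every vector in the span is approximately reached from a small one at all large times; together
  with the periodicity of the span this gives mixing and chaos.

  On the other hand, if \<open>x\<close>, \<open>T\<^sup>q x\<close> and \<open>T\<^sup>2\<^sup>q x\<close> are all bounded, then a block can contribute to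
  lower blocks at these times only with a tiny coefficient, because three positions \<open>i\<close>, \<open>i + q\<close>, \<open>i + 2q\<close> on its cycle
  that are not all of the same kind cannot all have small size. Removing the blocks one after another from the
  top shows that the coordinate at the fixed block \<open>0\<close> is almost the same for \<open>x\<close> and \<open>T\<^sup>q x\<close>,
  so bounded \<open>U\<^sub>0\<close>, \<open>U\<^sub>1\<close>, \<open>U\<^sub>2\<close> whose members in \<open>U\<^sub>0\<close> and \<open>U\<^sub>1\<close> differ in this coordinate refute d-transitivity.
\<close>

section \<open>Operators on the sequence space\<close>

lemma coord_add: "coord (x + y) n = coord x n + coord y n"
  by (simp add: plus_ell2.rep_eq)

lemma coord_cscale: "coord (c *\<^sub>C x) n = c * coord x n"
  by (simp add: cscale.rep_eq)

lemma coord_zero: "coord 0 n = 0"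
  by (simp add: zero_ell2.rep_eq)

lemma coord_sum: "coord (\<Sum>a\<in>A. f a) n = (\<Sum>a\<in>A. coord (f a) n)"
  by (induction A rule: infinite_finite_induct) (auto simp: coord_add coord_zero)

lemma norm_cscale: "norm (c *\<^sub>C x) = cmod c * norm x"
proof -
  have "(norm (c *\<^sub>C x))\<^sup>2 = (cmod c * norm x)\<^sup>2"
    using square_summable_coord[of x]
    by (simp add: norm_ell2_power2 coord_cscale norm_mult power_mult_distrib suminf_mult
        square_summable_def)
  then show ?thesis
    by (rule power2_eq_imp_eq) auto
qed

section \<open>Unit vectors, truncation and separability\<close>

lift_definition unit_vec :: "nat \<Rightarrow> ell2" is "\<lambda>n j. if j = n then 1 else 0"
proof -
  fix n :: nat
  show "square_summable (\<lambda>j. if j = n then 1 else 0)"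
    unfolding square_summable_def by (rule summable_finite[of "{n}"]) auto
qed

lemma coord_unit_vec: "coord (unit_vec n) j = (if j = n then 1 else 0)"
  by (simp add: unit_vec.rep_eq)

lemma norm_unit_vec: "norm (unit_vec n) = 1"
proof -
  have "(\<Sum>j. (cmod (coord (unit_vec n) j))\<^sup>2) = (\<Sum>j\<in>{n}. (cmod (coord (unit_vec n) j))\<^sup>2)"
    by (rule suminf_finite) (auto simp: coord_unit_vec)
  then show ?thesis
    unfolding norm_ell2_def by (simp add: coord_unit_vec)
qed

lemma truncation_tendsto: "(\<lambda>N. \<Sum>n<N. coord x n *\<^sub>C unit_vec n) \<longlonglongrightarrow> x"
proof -
  let ?f = "\<lambda>n. (cmod (coord x n))\<^sup>2"
  let ?t = "\<lambda>N. \<Sum>n<N. coord x n *\<^sub>C unit_vec n"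
  have f: "?f sums (norm x)\<^sup>2"
    using square_summable_coord[of x] unfolding square_summable_def norm_ell2_power2
    by (rule summable_sums)
  \<comment> \<open>The squared truncation error is the tail of the series for the squared
    norm.\<close>
  have eq: "(norm (?t N - x))\<^sup>2 = (norm x)\<^sup>2 - (\<Sum>n<N. ?f n)" for N
  proof -
    have c: "coord (?t N) j = (if j < N then coord x j else 0)" for j
      by (simp add: coord_sum coord_cscale coord_unit_vec if_distrib cong: if_cong)
    have "(\<lambda>n. ?f n - (if n \<in> {..<N} then ?f n else 0)) sums ((norm x)\<^sup>2 - (\<Sum>n<N. ?f n))"
      by (intro sums_diff f sums_If_finite_set) simp
    moreover have "(\<lambda>n. ?f n - (if n \<in> {..<N} then ?f n else 0))
        = (\<lambda>n. (cmod (coord (?t N - x) n))\<^sup>2)"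
      by (auto simp: c coord_diff)
    ultimately show ?thesis
      unfolding norm_ell2_power2 by (simp add: sums_iff)
  qed
  have "(\<lambda>N. (norm x)\<^sup>2 - (\<Sum>n<N. ?f n)) \<longlonglongrightarrow> (norm x)\<^sup>2 - (norm x)\<^sup>2"
    using f unfolding sums_def by (intro tendsto_intros)
  then have "(\<lambda>N. sqrt ((norm (?t N - x))\<^sup>2)) \<longlonglongrightarrow> sqrt 0"
    unfolding eq diff_self by (rule tendsto_real_sqrt)
  then have "(\<lambda>N. norm (?t N - x)) \<longlonglongrightarrow> 0"
    by (simp only: real_sqrt_abs abs_norm_cancel real_sqrt_zero)
  then show ?thesis
    by (rule LIM_zero_cancel[OF tendsto_norm_zero_cancel])
qed

lemma closure_span_unit_vec:
  assumes "\<And>n. unit_vec n \<in> ell2.span S"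
  shows "closure (ell2.span S) = UNIV"
proof -
  have "(\<Sum>n<N. coord x n *\<^sub>C unit_vec n) \<in> ell2.span S" for x N
    by (intro ell2.span_sum ell2.span_scale assms)
  then have "x \<in> closure (ell2.span S)" for x
    unfolding closure_sequential
    by (intro exI[of _ "\<lambda>N. \<Sum>n<N. coord x n *\<^sub>C unit_vec n"] conjI allI truncation_tendsto)
  then show ?thesis by blast
qed

lemma dense_meets_open: "closure A = UNIV \<Longrightarrow> open U \<Longrightarrow> U \<noteq> {} \<Longrightarrow> \<exists>x\<in>A. x \<in> U"
  using open_Int_closure_eq_empty[of U A] by auto

lemma ell2_countable_dense: "\<exists>A::ell2 set. countable A \<and> closure A = UNIV"
proof -
  obtain Q :: "complex set" where Q: "countable Q" "\<And>X. open X \<Longrightarrow> X \<noteq> {} \<Longrightarrow> \<exists>d\<in>Q. d \<in> X"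
    using countable_dense_setE by blast
  \<comment> \<open>Finite combinations with coefficients in a countable dense set of complex
    numbers; \<open>PiE\<close> fixes the irrelevant values, so that only countably many functions
    occur for each \<open>N\<close>.\<close>
  define A where "A = (\<Union>N. (\<lambda>c. \<Sum>n<N. c n *\<^sub>C unit_vec n) ` PiE {..<N} (\<lambda>_. Q))"
  have "countable A"
    unfolding A_def using Q(1) by (intro countable_UN countable_image countable_PiE) auto
  moreover have "x \<in> closure A" for x
  proof (rule iffD2[OF closure_approachable], intro allI impI)
    fix e :: real assume e: "0 < e"
    obtain N where N: "norm ((\<Sum>n<N. coord x n *\<^sub>C unit_vec n) - x) < e / 2"
      using LIMSEQ_D[OF truncation_tendsto[of x], of "e/2"] e by auto
    \<comment> \<open>The \<open>N\<close> coefficient errors then add up to at most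
      \<open>e / 2\<close>; the \<open>+ 1\<close> avoids division by zero at
      \<open>N = 0\<close>.\<close>
    define d where "d = e / (2 * (real N + 1))"
    have d: "0 < d" using e by (simp add: d_def)
    have "\<exists>q\<in>Q. q \<in> ball (coord x n) d" for n
      using d by (intro Q(2)) auto
    then obtain c where c: "\<And>n. c n \<in> Q" "\<And>n. c n \<in> ball (coord x n) d"
      by metis
    let ?y = "\<Sum>n<N. c n *\<^sub>C unit_vec n"
    have "?y = (\<Sum>n<N. restrict c {..<N} n *\<^sub>C unit_vec n)"
      by (intro sum.cong) auto
    then have "?y \<in> A"
      unfolding A_def using c(1) by (intro UN_I[of N] image_eqI[of _ _ "restrict c {..<N}"]) auto
    moreover have "norm (?y - (\<Sum>n<N. coord x n *\<^sub>C unit_vec n)) \<le> (\<Sum>n<N. d)"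
      unfolding sum_subtractf[symmetric] ell2.scale_left_diff_distrib[symmetric]
      using c(2) by (intro order_trans[OF norm_sum] sum_mono)
        (auto simp: norm_cscale norm_unit_vec dist_norm norm_minus_commute less_imp_le)
    moreover have "(\<Sum>n<N. d) \<le> e / 2"
      using e by (simp add: d_def field_simps)
    ultimately have "?y \<in> A" "norm (?y - x) < e"
      using N norm_triangle_ineq[of "?y - (\<Sum>n<N. coord x n *\<^sub>C unit_vec n)"
          "(\<Sum>n<N. coord x n *\<^sub>C unit_vec n) - x"]
      by simp_all
    then show "\<exists>y\<in>A. dist y x < e"
      by (auto simp: dist_norm)
  qed
  ultimately show ?thesis by blast
qed

section \<open>Bounded complex-linear maps\<close>

lemma bounded_clinearI:
  assumes "\<And>x y. T (x + y) = T x + T y" "\<And>c x. T (c *\<^sub>C x) = c *\<^sub>C T x"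
    and "\<And>x. norm (T x) \<le> norm x * C"
  shows "bounded_clinear T"
  unfolding bounded_clinear_def
proof
  show "bounded_linear T"
    by (rule bounded_linear_intro[of T C]) (auto simp: assms scaleR_eq_cscale)
  show "Vector_Spaces.linear (*\<^sub>C) (*\<^sub>C) T"
    unfolding Vector_Spaces.linear_iff using assms ell2.vector_space_axioms by auto
qed

lemma bounded_clinearD:
  assumes "bounded_clinear T"
  shows "T (x + y) = T x + T y" "T (c *\<^sub>C x) = c *\<^sub>C T x" "bounded_linear T"
  using assms unfolding bounded_clinear_def Vector_Spaces.linear_iff by auto

lemma bounded_clinear_add:
  assumes "bounded_clinear S" "bounded_clinear T"
  shows "bounded_clinear (\<lambda>x. S x + T x)"
  using bounded_linear_add[OF assms[THEN bounded_clinearD(3)]]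
    assms[THEN bounded_clinearD(1)] assms[THEN bounded_clinearD(2)]
  unfolding bounded_clinear_def Vector_Spaces.linear_iff
  by (auto simp: ell2.scale_right_distrib ell2.vector_space_axioms)

lemma bounded_clinear_funpow:
  assumes "bounded_clinear T"
  shows "bounded_clinear (T ^^ n)"
proof (induction n)
  case 0
  show ?case
    by (rule bounded_clinearI[of _ 1]) auto
next
  case (Suc n)
  have "bounded_linear (T \<circ> (T ^^ n))"
    using bounded_linear_compose[OF bounded_clinearD(3)[OF assms] bounded_clinearD(3)[OF Suc]]
    by (simp add: comp_def)
  then show ?case
    using bounded_clinearD(1,2)[OF assms] bounded_clinearD(1,2)[OF Suc]
    unfolding bounded_clinear_def Vector_Spaces.linear_iff
    by (auto simp: ell2.vector_space_axioms)
qed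

lemma bounded_clinear_sum:
  assumes "bounded_clinear T"
  shows "T (\<Sum>a\<in>A. f a) = (\<Sum>a\<in>A. T (f a))"
  using bounded_clinearD(3)[OF assms] by (simp add: linear_sum bounded_linear.linear)

lemma bounded_clinear_diff:
  assumes "bounded_clinear T"
  shows "T (x - y) = T x - T y"
  using bounded_clinearD(3)[OF assms] by (simp add: linear_diff bounded_linear.linear)

lemma bounded_clinear_zero:
  assumes "bounded_clinear T"
  shows "T 0 = 0"
  using bounded_clinearD(3)[OF assms] by (simp add: linear_0 bounded_linear.linear)

text \<open>
  The guard makes the function total: without injectivity and bounded weights the
  composition need not be square-summable, and the value is then \<open>0\<close>.
\<close>

lift_definition weighted_comp :: "(nat \<Rightarrow> complex) \<Rightarrow> (nat \<Rightarrow> nat) \<Rightarrow> ell2 \<Rightarrow> ell2" is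
  "\<lambda>w \<tau> x n. if inj \<tau> \<and> (\<forall>n. cmod (w n) \<le> 2) then w n * x (\<tau> n) else 0"
proof -
  fix w :: "nat \<Rightarrow> complex" and \<tau> :: "nat \<Rightarrow> nat" and x :: "nat \<Rightarrow> complex"
  assume x: "square_summable x"
  show "square_summable (\<lambda>n. if inj \<tau> \<and> (\<forall>n. cmod (w n) \<le> 2) then w n * x (\<tau> n) else 0)"
  proof (cases "inj \<tau> \<and> (\<forall>n. cmod (w n) \<le> 2)")
    case True
    have "summable (\<lambda>n. 4 * ((\<lambda>n. (cmod (x n))\<^sup>2) \<circ> \<tau>) n)"
      using x True unfolding square_summable_def
      by (intro summable_mult summable_reindex) auto
    then have "summable (\<lambda>n. (cmod (w n * x (\<tau> n)))\<^sup>2)"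
    proof (rule summable_comparison_test')
      fix n
      have "(cmod (w n))\<^sup>2 \<le> 2\<^sup>2"
        using True by (intro power_mono) auto
      then have "(cmod (w n))\<^sup>2 * (cmod (x (\<tau> n)))\<^sup>2 \<le> 4 * (cmod (x (\<tau> n)))\<^sup>2"
        by (intro mult_right_mono) auto
      then show "norm ((cmod (w n * x (\<tau> n)))\<^sup>2) \<le> 4 * ((\<lambda>n. (cmod (x n))\<^sup>2) \<circ> \<tau>) n"
        by (simp add: norm_mult power_mult_distrib)
    qed
    then show ?thesis
      using True by (simp add: square_summable_def)
  next
    case False
    then show ?thesis
      unfolding if_not_P[OF False] using square_summable_0 by simp
  qed
qed

lemma coord_weighted_comp:
  "inj \<tau> \<Longrightarrow> (\<And>n. cmod (w n) \<le> 2) \<Longrightarrow> coord (weighted_comp w \<tau> x) n = w n * coord x (\<tau> n)"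
  by (simp add: weighted_comp.rep_eq)

text \<open>Reindexing by an injective map cannot increase a sum of squares, and the weights
  contribute a factor of at most 4 to it, whence the operator bound 2.\<close>

lemma bounded_clinear_weighted_comp:
  assumes "inj \<tau>" "\<And>n. cmod (w n) \<le> 2"
  shows "bounded_clinear (weighted_comp w \<tau>)"
proof (rule bounded_clinearI[of _ 2])
  note c = coord_weighted_comp[OF assms]
  fix x y c
  show "weighted_comp w \<tau> (x + y) = weighted_comp w \<tau> x + weighted_comp w \<tau> y"
    by (rule coord_inject[THEN iffD1]) (auto simp: fun_eq_iff c coord_add algebra_simps)
  show "weighted_comp w \<tau> (c *\<^sub>C x) = c *\<^sub>C weighted_comp w \<tau> x"
    by (rule coord_inject[THEN iffD1]) (auto simp: fun_eq_iff c coord_cscale)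
  have x: "summable (\<lambda>n. (cmod (coord x n))\<^sup>2)" for x
    using square_summable_coord[of x] by (simp add: square_summable_def)
  have bd: "(cmod (coord (weighted_comp w \<tau> x) n))\<^sup>2 \<le> 4 * ((\<lambda>n. (cmod (coord x n))\<^sup>2) \<circ> \<tau>) n" for n
  proof -
    have "(cmod (w n))\<^sup>2 \<le> 2\<^sup>2"
      using assms by (intro power_mono) auto
    then have "(cmod (w n))\<^sup>2 * (cmod (coord x (\<tau> n)))\<^sup>2 \<le> 4 * (cmod (coord x (\<tau> n)))\<^sup>2"
      by (intro mult_right_mono) auto
    then show ?thesis
      by (simp add: c norm_mult power_mult_distrib)
  qed
  have re: "summable ((\<lambda>n. (cmod (coord x n))\<^sup>2) \<circ> \<tau>)"
    "suminf ((\<lambda>n. (cmod (coord x n))\<^sup>2) \<circ> \<tau>) \<le> (norm x)\<^sup>2"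
    using x assms(1) unfolding norm_ell2_power2
    by (auto intro!: summable_reindex suminf_reindex_mono)
  have "(norm (weighted_comp w \<tau> x))\<^sup>2 \<le> (\<Sum>n. 4 * ((\<lambda>n. (cmod (coord x n))\<^sup>2) \<circ> \<tau>) n)"
    unfolding norm_ell2_power2 by (intro suminf_le bd x summable_mult re)
  also have "\<dots> \<le> 4 * (norm x)\<^sup>2"
    using re by (subst suminf_mult) auto
  also have "\<dots> = (norm x * 2)\<^sup>2"
    by (simp add: power_mult_distrib)
  finally show "norm (weighted_comp w \<tau> x) \<le> norm x * 2"
    by (rule power2_le_imp_le) simp
qed

text \<open>The map sends \<open>unit_vec n\<close> to \<open>R n\<close>. Coordinates are bounded
  by the norm, so the series converges absolutely and the sum of the norms of the \<open>R n\<close>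
  is an operator bound.\<close>

lemma bounded_clinear_series:
  fixes R :: "nat \<Rightarrow> ell2"
  assumes "summable (\<lambda>n. norm (R n))"
  shows "bounded_clinear (\<lambda>x. \<Sum>n. coord x n *\<^sub>C R n)"
proof (rule bounded_clinearI[of _ "\<Sum>n. norm (R n)"])
  have le: "norm (coord x n *\<^sub>C R n) \<le> norm x * norm (R n)" for x n
    by (simp add: norm_cscale mult_right_mono cmod_coord_le_norm)
  have abs: "summable (\<lambda>n. norm (coord x n *\<^sub>C R n))" for x
    by (rule summable_comparison_test'[OF summable_mult[OF assms, of "norm x"]]) (use le in auto)
  note s = summable_norm_cancel[OF abs]
  fix x y c
  show "(\<Sum>n. coord (x + y) n *\<^sub>C R n) = (\<Sum>n. coord x n *\<^sub>C R n) + (\<Sum>n. coord y n *\<^sub>C R n)"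
    by (simp add: coord_add ell2.scale_left_distrib suminf_add[OF s s])
  have cs: "bounded_linear ((*\<^sub>C) c)"
    by (rule bounded_clinearD(3)[OF bounded_clinearI[of _ "cmod c"]])
      (auto simp: ell2.scale_right_distrib ell2.scale_left_commute norm_cscale)
  show "(\<Sum>n. coord (c *\<^sub>C x) n *\<^sub>C R n) = c *\<^sub>C (\<Sum>n. coord x n *\<^sub>C R n)"
    unfolding bounded_linear.suminf[OF cs s]
    by (simp only: coord_cscale ell2.scale_scale)
  have "norm (\<Sum>n. coord x n *\<^sub>C R n) \<le> (\<Sum>n. norm (coord x n *\<^sub>C R n))"
    by (rule summable_norm[OF abs])
  also have "\<dots> \<le> (\<Sum>n. norm x * norm (R n))"
    by (intro suminf_le le abs summable_mult assms)
  also have "\<dots> = norm x * (\<Sum>n. norm (R n))"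
    by (rule suminf_mult[OF assms])
  finally show "norm (\<Sum>n. coord x n *\<^sub>C R n) \<le> norm x * (\<Sum>n. norm (R n))" .
qed

text \<open>Birkhoff's argument: the vectors whose orbit enters every ball of a countable family
  form a countable intersection of sets that are open by continuity and dense by mixing, so Baire's
  theorem provides one.\<close>

lemma hypercyclic_if_mixing:
  fixes T :: "ell2 \<Rightarrow> ell2"
  assumes "bounded_clinear T" "mixing T"
  shows "hypercyclic T"
proof -
  obtain A :: "ell2 set" where A: "countable A" "closure A = UNIV"
    using ell2_countable_dense by blast
  define G where "G = (\<lambda>(a, j::nat). \<Union>k. (T ^^ k) -` ball a (1 / Suc j)) ` (A \<times> UNIV)"
  have op: "open ((T ^^ k) -` U)" if "open U" for k U
    using bounded_clinearD(3)[OF bounded_clinear_funpow[OF assms(1)]] that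
    by (intro open_vimage) (auto intro: linear_continuous_on)
  have "Met_TC.mtopology closure_of \<Inter>G = UNIV"
  proof (rule Met_TC.metric_Baire_category)
    show "Met_TC.mcomplete TYPE(ell2)"
      by (auto simp: Met_TC.mcomplete_def Cauchy_convergent_iff convergent_def)
    show "countable G"
      unfolding G_def using A by (intro countable_image countable_SIGMA) auto
    fix W assume "W \<in> G"
    then obtain a j where W: "W = (\<Union>k. (T ^^ k) -` ball a (1 / Suc j))"
      unfolding G_def by auto
    have "\<exists>y\<in>W. dist y x < e" if "0 < e" for x e
    proof -
      have "open (ball x e) \<and> ball x e \<noteq> {} \<and> open (ball a (1 / Suc j)) \<and> ball a (1 / Suc j) \<noteq> {}"
        using that by auto
      then have "finite (- return_set T (ball x e) (ball a (1 / Suc j)))"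
        using assms(2) unfolding mixing_def by blast
      then obtain k where "k \<in> return_set T (ball x e) (ball a (1 / Suc j))"
        using infinite_UNIV_nat by (metis ComplI finite_subset subsetI)
      then show ?thesis
        unfolding W return_set_def by (fastforce simp: dist_commute)
    qed
    then have "closure W = UNIV"
      by (auto simp: closure_approachable)
    then show "openin Met_TC.mtopology W \<and> Met_TC.mtopology closure_of W = UNIV"
      unfolding W by (auto intro!: open_UN op)
  qed
  then have "\<Inter>G \<noteq> {}"
    by auto
  then obtain x where x: "x \<in> \<Inter>G" by blast
  have "\<exists>z\<in>{(T ^^ n) x |n. True}. dist z y < e" if e: "0 < e" for y e
  proof -
    obtain j where j: "1 / real (Suc j) < e / 2"
      using nat_approx_posE[of "e / 2"] e by auto
    obtain a where a: "a \<in> A" "dist a y < e / 2"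
      using A(2) e unfolding closure_approachable by (metis UNIV_I closure_approachable half_gt_zero)
    have "x \<in> (\<Union>k. (T ^^ k) -` ball a (1 / Suc j))"
      using x a(1) unfolding G_def by auto
    then obtain k where "dist a ((T ^^ k) x) < 1 / Suc j"
      by auto
    then have "dist ((T ^^ k) x) y < e"
      using a(2) j dist_triangle[of "(T ^^ k) x" y a] by (simp add: dist_commute)
    then show ?thesis by blast
  qed
  then show ?thesis
    unfolding hypercyclic_def by (intro exI[of _ x]) (auto simp: closure_approachable)
qed

section \<open>The operator\<close>

text \<open>\<open>cdist D a\<close> is the distance from \<open>a\<close> to the nearest multiple of \<open>D\<close>.\<close>

definition cdist :: "int \<Rightarrow> int \<Rightarrow> int" where
  "cdist D a = min (a mod D) ((- a) mod D)"

lemma cdist_mod: "cdist D (a mod D) = cdist D a"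
  by (simp add: cdist_def mod_minus_eq)

lemma cdist_cong: "a mod D = b mod D \<Longrightarrow> cdist D a = cdist D b"
  by (metis cdist_mod)

lemma cdist_minus: "cdist D (- a) = cdist D a"
  by (simp add: cdist_def min.commute)

lemma cdist_le_abs: "0 < D \<Longrightarrow> cdist D a \<le> \<bar>a\<bar>"
  using zmod_le_nonneg_dividend[of a D] zmod_le_nonneg_dividend[of "- a" D]
  by (cases "0 \<le> a") (auto simp: cdist_def min_le_iff_disj)

text \<open>Reduces the triangle inequality on the cycle to the one for integers: the smaller
  residue, up to sign, represents \<open>a\<close>.\<close>

lemma cdist_attained: "\<exists>e. a mod D = e mod D \<and> cdist D a = \<bar>e\<bar>" if "0 < D"
proof (cases "a mod D \<le> (- a) mod D")
  case True
  then show ?thesis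
    using that by (intro exI[of _ "a mod D"]) (auto simp: cdist_def)
next
  case False
  then show ?thesis
    using that by (intro exI[of _ "- ((- a) mod D)"]) (auto simp: cdist_def mod_minus_eq)
qed

lemma cdist_add: "cdist D (a + b) \<le> cdist D a + cdist D b" if "0 < D"
proof -
  obtain e where e: "a mod D = e mod D" "cdist D a = \<bar>e\<bar>"
    using cdist_attained[OF \<open>0 < D\<close>] by blast
  obtain e' where e': "b mod D = e' mod D" "cdist D b = \<bar>e'\<bar>"
    using cdist_attained[OF \<open>0 < D\<close>] by blast
  have "cdist D (a + b) = cdist D (e + e')"
    by (intro cdist_cong mod_add_cong e e')
  also have "\<dots> \<le> \<bar>e + e'\<bar>"
    by (rule cdist_le_abs[OF that])
  finally show ?thesis
    using e e' by linarith
qed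

lemma cdist_diff: "cdist D (a - b) \<le> cdist D a + cdist D b" if "0 < D"
  using cdist_add[OF that, of a "- b"] by (simp add: cdist_minus)

lemma cdist_eq: "0 \<le> a \<Longrightarrow> 2 * a \<le> D \<Longrightarrow> cdist D a = a"
  by (cases "a = 0") (auto simp: cdist_def zmod_zminus1_eq_if)

text \<open>From \<open>2 * a\<close> the way up to the multiple \<open>D\<close> has length at
  least \<open>a\<close>. Hence the factor 3 in \<open>period\<close>: it keeps twice the delay away
  from 0 on the cycle.\<close>

lemma cdist_double_ge: "0 \<le> a \<Longrightarrow> 3 * a \<le> D \<Longrightarrow> a \<le> cdist D (2 * a)"
  by (cases "a = 0") (auto simp: cdist_def zmod_zminus1_eq_if)

section \<open>Blocks with their delays, parents and periods\<close>

definition delay :: "nat \<Rightarrow> nat" where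
  "delay m = fst (prod_decode m)"

definition parent :: "nat \<Rightarrow> nat" where
  "parent m = snd (prod_decode m)"

lemma delay_le: "delay m \<le> m"
  using le_prod_encode_1[of "delay m" "parent m"] by (simp add: delay_def parent_def)

text \<open>
  Block \<open>m = prod_encode (k, l)\<close> moves a small vector to \<open>orb l 0\<close> in \<open>k\<close> steps, provided that \<open>k\<close> is
  so large that the size \<open>2 ^ (k div 4) / (k + 1)\<close> reached on the way dominates everything that
  the block contributes; otherwise the block is a single fixed vector. For every \<open>l\<close>
  all large \<open>k\<close> are admissible. The period of the parent divides that of the block, so that
  the orbits of the block close up.
\<close>

function period :: "nat \<Rightarrow> nat" where
  "period m =
    (if parent m < m then
      (if 0 < delay m \<and> 3 * delay m * period (parent m) * 2 ^ (parent m + 1) * (delay m + 1)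
          * (32 * (m + 1) * (m + 2)) \<le> 2 ^ (delay m div 4)
       then 3 * delay m * period (parent m) else 1)
     else 1)"
  by auto
termination by (relation "Wellfounded.measure id") auto

declare period.simps [simp del]

text \<open>The test in the recursion for \<open>period\<close>, named afterwards because it
  involves \<open>period\<close> of the parent.\<close>

definition attached :: "nat \<Rightarrow> bool" where
  "attached m \<longleftrightarrow> parent m < m \<and> 0 < delay m \<and>
    3 * delay m * period (parent m) * 2 ^ (parent m + 1) * (delay m + 1)
      * (32 * (m + 1) * (m + 2)) \<le> 2 ^ (delay m div 4)"

lemma period_eq: "period m = (if attached m then 3 * delay m * period (parent m) else 1)"
  by (subst period.simps) (auto simp: attached_def)

lemma period_pos: "0 < period m"
proof (induction m rule: less_induct)
  case (less m)
  then show ?case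
    by (subst period_eq) (auto simp: attached_def)
qed

lemma attachedD:
  assumes "attached m"
  shows "parent m < m" "0 < delay m" "3 * int (delay m) \<le> int (period m)"
    "int (period (parent m)) dvd int (period m)" "1 \<le> delay m div 4"
    "period m * 2 ^ (parent m + 1) * (delay m + 1) * (32 * (m + 1) * (m + 2)) \<le> 2 ^ (delay m div 4)"
proof -
  show "parent m < m" "0 < delay m"
    using assms by (auto simp: attached_def)
  have p: "period m = 3 * delay m * period (parent m)"
    using assms by (simp add: period_eq)
  show "int (period (parent m)) dvd int (period m)"
    unfolding p by simp
  have "3 * delay m * 1 \<le> period m"
    unfolding p using period_pos[of "parent m"] by (intro mult_left_mono) auto
  then show "3 * int (delay m) \<le> int (period m)"
    by linarith
  show bd: "period m * 2 ^ (parent m + 1) * (delay m + 1) * (32 * (m + 1) * (m + 2)) \<le> 2 ^ (delay m div 4)"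
    using assms unfolding p by (simp add: attached_def)
  \<comment> \<open>A left side of at least 2 excludes the exponent 0.\<close>
  have "1 * 1 * 1 * (2 * 1 * 1) \<le> period m * 2 ^ (parent m + 1) * (delay m + 1) * (32 * (m + 1) * (m + 2))"
    using period_pos[of m] by (intro mult_mono) auto
  then have "(2::nat) \<le> 2 ^ (delay m div 4)"
    using bd by linarith
  then show "1 \<le> delay m div 4"
    by (cases "delay m div 4") auto
qed

text \<open>
  On the cycle of an attached block the size is \<open>1 / (k + 1)\<close> at the positions \<open>0\<close> and \<open>k\<close>, doubles with
  each step away from them, and is capped at \<open>max_size\<close>. The gate is open around \<open>k\<close> and it changes
  only where the size is maximal, which makes the jumps summable.
\<close>

definition depth :: "nat \<Rightarrow> int \<Rightarrow> nat" where
  "depth m i = nat (min (int (delay m div 4))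
    (min (cdist (period m) i) (cdist (period m) (i - delay m))))"

definition size_at :: "nat \<Rightarrow> int \<Rightarrow> real" where
  "size_at m i = (if attached m then 2 ^ depth m i / (delay m + 1) else 1)"

definition max_size :: "nat \<Rightarrow> real" where
  "max_size m = 2 ^ (delay m div 4) / (delay m + 1)"

definition gate :: "nat \<Rightarrow> int \<Rightarrow> bool" where
  "gate m i \<longleftrightarrow> attached m \<and> cdist (period m) (i - delay m) \<le> int (delay m div 4)"

text \<open>Pairs of block and position relabel the standard basis: block \<open>m\<close> owns one
  unit vector for each position of its cycle.\<close>

definition idx :: "(nat \<times> int) set" where
  "idx = {(m, i). 0 \<le> i \<and> i < int (period m)}"

text \<open>Reducing \<open>i\<close> lets positions be arbitrary integers, so that shifts need no
  case distinction at the end of the cycle.\<close>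

definition code :: "nat \<Rightarrow> int \<Rightarrow> nat" where
  "code m i = to_nat_on idx (m, i mod int (period m))"

definition basis_vec :: "nat \<Rightarrow> int \<Rightarrow> ell2" where
  "basis_vec m i = unit_vec (code m i)"

function orb :: "nat \<Rightarrow> int \<Rightarrow> ell2" where
  "orb m i = complex_of_real (size_at m i) *\<^sub>C basis_vec m i
    + (if gate m i then orb (parent m) (i - delay m) else 0)"
  by auto
termination by (relation "Wellfounded.measure fst") (auto simp: gate_def attached_def)

declare orb.simps [simp del]

section \<open>Estimates for sizes, gates and orbit vectors\<close>

lemma size_at_pos: "0 < size_at m i"
  by (simp add: size_at_def)

lemma depth_le: "depth m i \<le> delay m div 4"
  by (simp add: depth_def)

lemma size_at_le: "size_at m i \<le> 2 ^ m"
proof (cases "attached m")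
  case True
  have "(2::real) ^ depth m i / (delay m + 1) \<le> 2 ^ m / 1"
    using depth_le[of m i] delay_le[of m] by (intro frac_le power_increasing) auto
  then show ?thesis
    by (simp add: size_at_def True)
qed (simp add: size_at_def)

lemma mod_shift_cong: "i mod D = j mod D \<Longrightarrow> (i - c) mod D = (j - c) mod D" for i j c D :: int
  by (rule mod_diff_cong) auto

lemma size_at_cong: "i mod int (period m) = j mod int (period m) \<Longrightarrow> size_at m i = size_at m j"
  unfolding size_at_def depth_def
  using cdist_cong[of i "int (period m)" j] cdist_cong[OF mod_shift_cong, of i "int (period m)" j "delay m"]
  by simp

lemma gate_cong: "i mod int (period m) = j mod int (period m) \<Longrightarrow> gate m i = gate m j"
  unfolding gate_def
  using cdist_cong[OF mod_shift_cong, of i "int (period m)" j "delay m"] by simp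

text \<open>A congruence modulo the period of the block passes to the parent, because the parent's
  period divides it.\<close>

lemma orb_cong: "i mod int (period m) = j mod int (period m) \<Longrightarrow> orb m i = orb m j"
proof (induction m arbitrary: i j rule: less_induct)
  case (less m)
  have "orb (parent m) (i - delay m) = orb (parent m) (j - delay m)" if "gate m i"
  proof (rule less.IH)
    have a: "attached m" using that by (simp add: gate_def)
    show "parent m < m" by (rule attachedD(1)[OF a])
    have "(i - delay m) mod int (period m) = (j - delay m) mod int (period m)"
      by (rule mod_shift_cong[OF less.prems])
    then show "(i - delay m) mod int (period (parent m)) = (j - delay m) mod int (period (parent m))"
      by (metis attachedD(4)[OF a] mod_mod_cancel)
  qed
  then show ?case
    using size_at_cong[OF less.prems] gate_cong[OF less.prems] less.prems
    by (subst (1 2) orb.simps) (auto simp: basis_vec_def code_def)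
qed

text \<open>The own part contributes at most \<open>2 ^ m\<close>, and so does the parent, whose
  number is smaller.\<close>

lemma norm_orb_le: "norm (orb m i) \<le> 2 ^ (m + 1)"
proof (induction m arbitrary: i rule: less_induct)
  case (less m)
  have "norm (if gate m i then orb (parent m) (i - delay m) else 0) \<le> 2 ^ m"
  proof (cases "gate m i")
    case True
    then have l: "parent m < m" by (simp add: gate_def attached_def)
    have "norm (orb (parent m) (i - delay m)) \<le> 2 ^ (parent m + 1)"
      by (rule less.IH[OF l])
    also have "\<dots> \<le> 2 ^ m"
      using l by (intro power_increasing) auto
    finally show ?thesis using True by simp
  qed simp
  moreover have "norm (complex_of_real (size_at m i) *\<^sub>C basis_vec m i) \<le> 2 ^ m"
    using size_at_le[of m i] size_at_pos[of m i]
    by (simp add: norm_cscale basis_vec_def norm_unit_vec)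
  ultimately show ?case
    using norm_triangle_ineq[of "complex_of_real (size_at m i) *\<^sub>C basis_vec m i"
        "if gate m i then orb (parent m) (i - delay m) else 0"]
    by (subst orb.simps) simp
qed

text \<open>Distances on the cycle grow by at most 1 per step. This keeps the weights of the shift
  within the bound 2 required by \<open>weighted_comp\<close>.\<close>

lemma size_at_Suc_le: "size_at m (i + 1) \<le> 2 * size_at m i"
proof (cases "attached m")
  case True
  have D: "0 < int (period m)" using period_pos by simp
  have "cdist (period m) (a + 1) \<le> cdist (period m) a + 1" for a
    using cdist_add[OF D, of a 1] cdist_le_abs[OF D, of 1] by simp
  from this[of i] this[of "i - delay m"]
  have "depth m (i + 1) \<le> depth m i + 1"
    unfolding depth_def by (simp add: algebra_simps)
  then have "(2::real) ^ depth m (i + 1) \<le> 2 ^ (depth m i + 1)"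
    by (intro power_increasing) auto
  then show ?thesis
    by (simp add: size_at_def True divide_right_mono)
qed (simp add: size_at_def)

lemma size_at_eq_max:
  assumes "attached m" "int (delay m div 4) \<le> cdist (period m) i"
    "int (delay m div 4) \<le> cdist (period m) (i - delay m)"
  shows "size_at m i = max_size m"
  using assms by (simp add: size_at_def max_size_def depth_def)

lemma cdist_delay: "attached m \<Longrightarrow> cdist (period m) (delay m) = delay m"
  using attachedD(3)[of m] by (intro cdist_eq) auto

text \<open>With \<open>r = delay m div 4\<close>, a gate change puts \<open>i\<close> at distance
  \<open>r\<close> or \<open>r + 1\<close> from the delay, hence at least \<open>r\<close> from 0,
  because \<open>4 * r\<close> is at most the delay and \<open>r\<close> is at least 1.\<close>

lemma size_at_gate_change:
  assumes "attached m" "gate m (i + 1) \<noteq> gate m i"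
  shows "size_at m i = max_size m"
proof (rule size_at_eq_max[OF assms(1)])
  have D: "0 < int (period m)" using period_pos by simp
  define a where "a = cdist (period m) (i - delay m)"
  define b where "b = cdist (period m) (i + 1 - delay m)"
  have ab: "b \<le> a + 1" "a \<le> b + 1"
    using cdist_add[OF D, of "i - delay m" 1] cdist_diff[OF D, of "i + 1 - delay m" 1]
      cdist_le_abs[OF D, of 1]
    by (auto simp: a_def b_def algebra_simps)
  have "int (delay m) \<le> cdist (period m) i + a"
    using cdist_diff[OF D, of i "i - delay m"] cdist_delay[OF assms(1)]
    by (simp add: a_def)
  moreover have "int (delay m div 4) \<le> a \<and> a \<le> int (delay m div 4) + 1"
    using assms ab unfolding gate_def a_def[symmetric] b_def[symmetric] by auto
  moreover have "4 * int (delay m div 4) \<le> int (delay m)" "1 \<le> int (delay m div 4)"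
    using attachedD(5)[OF assms(1)] by linarith+
  ultimately show "int (delay m div 4) \<le> cdist (period m) i"
    "int (delay m div 4) \<le> cdist (period m) (i - delay m)"
    unfolding a_def[symmetric] by linarith+
qed

text \<open>What a weighted shift misses when the gate opens or closes after \<open>i\<close>: the
  parent's vector has to be added or removed. The factor \<open>1 / size_at m i\<close> refers this
  to the basis vector instead of its multiple.\<close>

definition jump :: "nat \<Rightarrow> int \<Rightarrow> ell2" where
  "jump m i = complex_of_real (1 / size_at m i) *\<^sub>C
    ((if gate m (i + 1) then orb (parent m) (i + 1 - delay m) else 0)
     - (if gate m i then orb (parent m) (i + 1 - delay m) else 0))"

text \<open>Bounds the norms of the jumps of a block summed over its cycle; the descent below loses
  a multiple of the same quantity.\<close>

definition err :: "nat \<Rightarrow> real" where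
  "err m = (if attached m then period m * (2 ^ (parent m + 1) / max_size m) else 0)"

lemma err_le: "err m \<le> 1 / (32 * (real m + 1) * (real m + 2))"
proof (cases "attached m")
  case True
  define X where "X = real (period m * 2 ^ (parent m + 1) * (delay m + 1))"
  define Y where "Y = 32 * (real m + 1) * (real m + 2)"
  have e: "err m = X / 2 ^ (delay m div 4)"
    by (simp add: err_def True max_size_def X_def algebra_simps)
  have "X * Y = real (period m * 2 ^ (parent m + 1) * (delay m + 1) * (32 * (m + 1) * (m + 2)))"
    by (simp add: X_def Y_def algebra_simps)
  also have "\<dots> \<le> real (2 ^ (delay m div 4))"
    using attachedD(6)[OF True] by (rule of_nat_mono)
  finally have "X * Y \<le> 2 ^ (delay m div 4)"
    by simp
  moreover have "0 < Y"
    by (simp add: Y_def)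
  ultimately have "err m \<le> 1 / Y"
    unfolding e by (auto simp: divide_simps)
  then show ?thesis
    unfolding Y_def .
qed (simp add: err_def)

lemma max_size_pos: "0 < max_size m"
  by (simp add: max_size_def)

lemma err_nonneg: "0 \<le> err m"
  using max_size_pos[of m] by (simp add: err_def)

text \<open>The factor \<open>32 * (m + 1) * (m + 2)\<close> in \<open>attached\<close> makes the
  bounds for \<open>err\<close> telescope. The value 1 / 32 serves the final numerical
  contradiction.\<close>

lemma sum_err_le: "(\<Sum>m<N. err m) \<le> 1 / 32"
proof -
  have "(\<Sum>m<N. err m) \<le> (1 - 1 / (real N + 1)) / 32"
  proof (induction N)
    case (Suc N)
    have "(1 - 1 / (real N + 1)) / 32 + 1 / (32 * (real N + 1) * (real N + 2))
        = (1 - 1 / (real (Suc N) + 1)) / 32"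
      by (simp add: divide_simps) (simp add: algebra_simps)
    moreover have "(\<Sum>m<Suc N. err m) = (\<Sum>m<N. err m) + err N"
      by simp
    ultimately show ?case
      using Suc err_le[of N] by linarith
  qed simp
  then show ?thesis
    by (smt (verit) divide_nonneg_nonneg of_nat_0_le_iff divide_right_mono)
qed

text \<open>A nonzero jump needs a gate change, and there the division is by
  \<open>max_size m\<close>.\<close>

lemma norm_jump_le: "norm (jump m i) \<le> err m / period m"
proof (cases "gate m (i + 1) = gate m i")
  case True
  then show ?thesis
    using err_nonneg[of m] by (simp add: jump_def)
next
  case False
  then have a: "attached m" by (auto simp: gate_def)
  have "norm (jump m i) = 1 / max_size m * norm (orb (parent m) (i + 1 - delay m))"
    using False size_at_gate_change[OF a False] max_size_pos[of m]
    by (auto simp: jump_def norm_cscale simp del: of_real_divide)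
  also have "\<dots> \<le> 1 / max_size m * 2 ^ (parent m + 1)"
    using norm_orb_le[of "parent m"] max_size_pos[of m] by (intro mult_left_mono) auto
  also have "\<dots> = err m / period m"
    using a period_pos[of m] by (simp add: err_def)
  finally show ?thesis .
qed

section \<open>Enumeration of the basis and construction of the operator\<close>

lemma countable_idx: "countable idx"
  by (rule countableI_type)

text \<open>Infinitude makes \<open>to_nat_on idx\<close> onto, so that every coordinate belongs to
  some block.\<close>

lemma infinite_idx: "infinite idx"
proof -
  have "(\<lambda>m. (m, 0)) ` UNIV \<subseteq> idx"
    using period_pos by (auto simp: idx_def)
  moreover have "infinite ((\<lambda>m. (m, 0::int)) ` (UNIV :: nat set))"
    by (intro range_inj_infinite) (auto simp: inj_def)
  ultimately show ?thesis
    using infinite_super by blast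
qed

lemma mod_period_idx: "(m, i mod int (period m)) \<in> idx"
  using period_pos[of m] by (auto simp: idx_def)

lemma code_eq_iff: "code m i = code m' j \<longleftrightarrow> m = m' \<and> i mod int (period m) = j mod int (period m)"
  unfolding code_def using countable_idx mod_period_idx by (subst to_nat_on_inj) auto

lemma code_surj: "\<exists>m i. 0 \<le> i \<and> i < int (period m) \<and> n = code m i"
proof -
  obtain p where p: "p \<in> idx" "to_nat_on idx p = n"
    using to_nat_on_surj[OF countable_idx infinite_idx] by blast
  then show ?thesis
    by (intro exI[of _ "fst p"] exI[of _ "snd p"]) (auto simp: idx_def code_def)
qed

lemma from_nat_into_code: "from_nat_into idx (code m i) = (m, i mod int (period m))"
  unfolding code_def using countable_idx mod_period_idx by (rule from_nat_into_to_nat_on)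

text \<open>The ratio turns the multiple \<open>size_at m (i - 1)\<close> of one basis vector into
  the multiple \<open>size_at m i\<close> of the next. In coordinates the image is read off at the
  preceding position, hence \<open>pred_code\<close>.\<close>

definition weight :: "nat \<Rightarrow> real" where
  "weight n = (case from_nat_into idx n of (m, i) \<Rightarrow> size_at m i / size_at m (i - 1))"

definition pred_code :: "nat \<Rightarrow> nat" where
  "pred_code n = (case from_nat_into idx n of (m, i) \<Rightarrow> code m (i - 1))"

definition jump_code :: "nat \<Rightarrow> ell2" where
  "jump_code n = (case from_nat_into idx n of (m, i) \<Rightarrow> jump m i)"

lemma pred_code_code: "pred_code (code m i) = code m (i - 1)"
  by (simp add: pred_code_def from_nat_into_code code_eq_iff mod_diff_left_eq)

lemma weight_code: "weight (code m i) = size_at m i / size_at m (i - 1)"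
proof -
  have "size_at m (i mod int (period m)) = size_at m i"
    "size_at m (i mod int (period m) - 1) = size_at m (i - 1)"
    by (intro size_at_cong; simp add: mod_diff_left_eq)+
  then show ?thesis
    by (simp add: weight_def from_nat_into_code)
qed

lemma jump_cong: "i mod int (period m) = j mod int (period m) \<Longrightarrow> jump m i = jump m j"
proof -
  assume ij: "i mod int (period m) = j mod int (period m)"
  have ij1: "(i + 1) mod int (period m) = (j + 1) mod int (period m)"
    by (rule mod_add_cong[OF ij refl])
  have "orb (parent m) (i + 1 - delay m) = orb (parent m) (j + 1 - delay m)" if "attached m"
  proof (rule orb_cong)
    show "(i + 1 - delay m) mod int (period (parent m)) = (j + 1 - delay m) mod int (period (parent m))"
      by (metis attachedD(4)[OF that] mod_mod_cancel mod_shift_cong[OF ij1])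
  qed
  then show ?thesis
    unfolding jump_def using size_at_cong[OF ij] gate_cong[OF ij] gate_cong[OF ij1]
    by (auto simp: gate_def)
qed

lemma jump_code_code: "jump_code (code m i) = jump m i"
  using jump_cong[of "i mod int (period m)" m i] by (simp add: jump_code_def from_nat_into_code)

lemma inj_pred_code: "inj pred_code"
proof (rule injI)
  fix n n' assume eq: "pred_code n = pred_code n'"
  obtain m i where n: "n = code m i" using code_surj by blast
  obtain m' i' where n': "n' = code m' i'" using code_surj by blast
  have m: "m = m'" "(i - 1) mod int (period m) = (i' - 1) mod int (period m)"
    using eq by (auto simp: n n' pred_code_code code_eq_iff)
  have "(i - 1 + 1) mod int (period m) = (i' - 1 + 1) mod int (period m)"
    by (rule mod_add_cong[OF m(2) refl])
  then show "n = n'"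
    using m by (simp add: n n' code_eq_iff)
qed

lemma weight_le: "cmod (complex_of_real (weight n)) \<le> 2"
proof -
  obtain m i where n: "n = code m i" using code_surj by blast
  show ?thesis
    using size_at_Suc_le[of m "i - 1"] size_at_pos[of m i] size_at_pos[of m "i - 1"]
    unfolding n weight_code norm_of_real by (simp add: divide_simps)
qed

text \<open>Finitely many coordinates lie in finitely many complete cycles, and each cycle
  contributes at most \<open>err m\<close>.\<close>

lemma summable_jump_code: "summable (\<lambda>n. norm (jump_code n))"
proof (rule summableI_nonneg_bounded)
  fix M :: nat
  define A where "A = from_nat_into idx ` {..<M}"
  define N where "N = Suc (Max (fst ` A \<union> {0}))"
  have "idx \<noteq> {}"
    using infinite_idx by auto
  then have A: "finite A" "A \<subseteq> idx"
    using from_nat_into[of idx] by (auto simp: A_def simp del: split_paired_All)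
  have "fst p < N" if "p \<in> A" for p
    unfolding N_def using A(1) that by (intro le_imp_less_Suc Max_ge) auto
  then have sub: "A \<subseteq> (SIGMA m:{..<N}. {0..<int (period m)})"
    using A(2) by (force simp: idx_def)
  have "(\<Sum>n<M. norm (jump_code n)) = (\<Sum>n<M. (\<lambda>(m, i). norm (jump m i)) (from_nat_into idx n))"
    by (intro sum.cong) (auto simp: jump_code_def split: prod.splits)
  also have "\<dots> = (\<Sum>(m, i)\<in>A. norm (jump m i))"
    unfolding A_def using countable_idx infinite_idx
    by (subst sum.reindex) (auto simp: inj_on_def o_def)
  also have "\<dots> \<le> (\<Sum>(m, i)\<in>(SIGMA m:{..<N}. {0..<int (period m)}). norm (jump m i))"
    by (intro sum_mono2 sub) auto
  also have "\<dots> = (\<Sum>m<N. \<Sum>i\<in>{0..<int (period m)}. norm (jump m i))"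
    by (subst sum.Sigma) auto
  also have "\<dots> \<le> (\<Sum>m<N. \<Sum>i\<in>{0..<int (period m)}. err m / period m)"
    by (intro sum_mono norm_jump_le)
  also have "\<dots> = (\<Sum>m<N. err m)"
    using period_pos by (intro sum.cong) auto
  also have "\<dots> \<le> 1 / 32"
    by (rule sum_err_le)
  finally show "(\<Sum>n<M. norm (jump_code n)) \<le> 1 / 32" .
qed simp

text \<open>A direct sum of weighted cyclic shifts, perturbed by a nuclear operator that couples
  attached blocks to their parents.\<close>

definition op_T :: "ell2 \<Rightarrow> ell2" where
  "op_T x = weighted_comp (\<lambda>n. complex_of_real (weight n)) pred_code x
    + (\<Sum>n. coord x n *\<^sub>C jump_code n)"

lemma bounded_clinear_op_T: "bounded_clinear op_T"
  unfolding op_T_def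
  by (intro bounded_clinear_add bounded_clinear_weighted_comp bounded_clinear_series
      inj_pred_code weight_le summable_jump_code)

lemma op_T_basis_vec:
  "op_T (basis_vec m i) =
    complex_of_real (size_at m (i + 1) / size_at m i) *\<^sub>C basis_vec m (i + 1) + jump m i"
proof -
  have "weighted_comp (\<lambda>n. complex_of_real (weight n)) pred_code (basis_vec m i)
      = complex_of_real (size_at m (i + 1) / size_at m i) *\<^sub>C basis_vec m (i + 1)"
  proof (rule coord_inject[THEN iffD1], rule ext)
    fix n
    obtain m' j where n: "n = code m' j" using code_surj by blast
    have "(j - 1) mod int (period m) = i mod int (period m) \<longleftrightarrow> j mod int (period m) = (i + 1) mod int (period m)"
    proof
      assume "(j - 1) mod int (period m) = i mod int (period m)"
      from mod_add_cong[OF this refl, of 1] show "j mod int (period m) = (i + 1) mod int (period m)"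
        by simp
    next
      assume "j mod int (period m) = (i + 1) mod int (period m)"
      from mod_diff_cong[OF this refl, of 1] show "(j - 1) mod int (period m) = i mod int (period m)"
        by simp
    qed
    moreover have "size_at m j / size_at m (j - 1) = size_at m (i + 1) / size_at m i"
      if "j mod int (period m) = (i + 1) mod int (period m)"
      using size_at_cong[OF that] size_at_cong[OF mod_diff_cong[OF that refl, of 1]] by simp
    ultimately show "coord (weighted_comp (\<lambda>n. complex_of_real (weight n)) pred_code (basis_vec m i)) n
        = coord (complex_of_real (size_at m (i + 1) / size_at m i) *\<^sub>C basis_vec m (i + 1)) n"
      unfolding coord_weighted_comp[OF inj_pred_code weight_le] coord_cscale basis_vec_def
        coord_unit_vec n weight_code pred_code_code code_eq_iff
      by (auto simp del: of_real_divide)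
  qed
  moreover have "(\<Sum>n. coord (basis_vec m i) n *\<^sub>C jump_code n)
      = (\<Sum>n\<in>{code m i}. coord (basis_vec m i) n *\<^sub>C jump_code n)"
    by (rule suminf_finite) (auto simp: basis_vec_def coord_unit_vec)
  ultimately show ?thesis
    by (simp add: op_T_def basis_vec_def coord_unit_vec jump_code_code)
qed

text \<open>The weight turns one size into the next, the induction hypothesis moves the parent part,
  and the jump replaces the gate at \<open>i\<close> by the gate at \<open>i + 1\<close>.\<close>

lemma op_T_orb: "op_T (orb m i) = orb m (i + 1)"
proof (induction m arbitrary: i rule: less_induct)
  case (less m)
  note T = bounded_clinearD(1,2)[OF bounded_clinear_op_T] bounded_clinear_zero[OF bounded_clinear_op_T]
  have s: "size_at m i \<noteq> 0"
    using size_at_pos[of m i] by simp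
  have par: "op_T (if gate m i then orb (parent m) (i - delay m) else 0)
      = (if gate m i then orb (parent m) (i + 1 - delay m) else 0)"
    using less.IH[of "parent m" "i - delay m"]
    by (auto simp: T gate_def attached_def algebra_simps)
  have "op_T (orb m i) = complex_of_real (size_at m i) *\<^sub>C op_T (basis_vec m i)
      + (if gate m i then orb (parent m) (i + 1 - delay m) else 0)"
    by (subst orb.simps) (simp only: T par)
  also have "\<dots> = complex_of_real (size_at m (i + 1)) *\<^sub>C basis_vec m (i + 1)
     + (if gate m (i + 1) then orb (parent m) (i + 1 - delay m) else 0)"
    using s by (simp add: op_T_basis_vec jump_def ell2.scale_right_distrib)
  also have "\<dots> = orb m (i + 1)"
    by (subst (2) orb.simps) simp
  finally show ?case .
qed

lemma funpow_op_T_orb: "(op_T ^^ n) (orb m i) = orb m (i + int n)"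
  by (induction n) (auto simp: op_T_orb algebra_simps)

section \<open>Mixing and chaos\<close>

definition orb_span :: "nat \<Rightarrow> ell2 set" where
  "orb_span N = ell2.span {orb m i | m i. m < N}"

definition all_span :: "ell2 set" where
  "all_span = ell2.span {orb m i | m i. True}"

lemma funpow_op_T_add: "(op_T ^^ n) (x + y) = (op_T ^^ n) x + (op_T ^^ n) y"
  and funpow_op_T_scale: "(op_T ^^ n) (c *\<^sub>C x) = c *\<^sub>C (op_T ^^ n) x"
  and funpow_op_T_bounded: "bounded_linear (op_T ^^ n)"
  and funpow_op_T_diff: "(op_T ^^ n) (x - y) = (op_T ^^ n) x - (op_T ^^ n) y"
  and funpow_op_T_sum: "(op_T ^^ n) (\<Sum>a\<in>A. f a) = (\<Sum>a\<in>A. (op_T ^^ n) (f a))"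
  and funpow_op_T_zero: "(op_T ^^ n) 0 = 0"
  using bounded_clinear_funpow[OF bounded_clinear_op_T, of n]
  by (auto intro: bounded_clinearD bounded_clinear_diff bounded_clinear_zero bounded_clinear_sum)

lemma basis_vec_in_all_span: "basis_vec m i \<in> all_span"
proof -
  let ?g = "if gate m i then orb (parent m) (i - delay m) else 0"
  have in_span: "orb m i \<in> all_span" for m i
    unfolding all_span_def by (rule ell2.span_base) auto
  have "orb m i - ?g = complex_of_real (size_at m i) *\<^sub>C basis_vec m i"
    by (subst orb.simps) simp
  then have "basis_vec m i = complex_of_real (1 / size_at m i) *\<^sub>C (orb m i - ?g)"
    using size_at_pos[of m i] by simp
  also have "\<dots> \<in> all_span"
    using in_span unfolding all_span_def
    by (intro ell2.span_scale ell2.span_diff) (auto simp: ell2.span_zero)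
  finally show ?thesis .
qed

lemma closure_all_span: "closure all_span = UNIV"
  unfolding all_span_def
proof (rule closure_span_unit_vec)
  fix n
  obtain m i where "n = code m i" using code_surj by blast
  then show "unit_vec n \<in> ell2.span {orb m i | m i. True}"
    using basis_vec_in_all_span[of m i] by (simp add: basis_vec_def all_span_def)
qed

text \<open>Finitely many periodic orbits have a common period, built up here as a product.\<close>

lemma periodic_all_span:
  assumes "x \<in> all_span"
  shows "\<exists>k\<ge>1. (op_T ^^ k) x = x"
  using assms unfolding all_span_def
proof (induction rule: ell2.span_induct_alt)
  case base
  show ?case by (intro exI[of _ 1]) (auto simp: funpow_op_T_zero[of 1, simplified])
next
  case (step c x y)
  then obtain m i k where x: "x = orb m i" and k: "k \<ge> 1" "(op_T ^^ k) y = y"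
    by auto
  have "(op_T ^^ (period m * k)) x = x"
    unfolding x funpow_op_T_orb by (rule orb_cong) simp
  moreover have "(op_T ^^ (period m * k)) y = y"
    using funpow_mod_eq[OF k(2), of "period m * k"] by simp
  ultimately show ?case
    using k period_pos[of m]
    by (intro exI[of _ "period m * k"]) (auto simp: funpow_op_T_add funpow_op_T_scale)
qed

text \<open>The approximate right-inverse half of Kitai's mixing criterion; periodicity on
  \<open>all_span\<close> replaces the other half.\<close>

definition reachable :: "ell2 \<Rightarrow> bool" where
  "reachable y \<longleftrightarrow> (\<forall>e>0. \<exists>K. \<forall>k\<ge>K. \<exists>x. norm x < e \<and> norm ((op_T ^^ k) x - y) < e)"

lemma reachableD:
  assumes "reachable y" "0 < e"
  obtains K where "\<And>k. k \<ge> K \<Longrightarrow> \<exists>x. norm x < e \<and> norm ((op_T ^^ k) x - y) < e"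
  using assms unfolding reachable_def by blast

lemma reachable_zero: "reachable 0"
  unfolding reachable_def by (auto intro!: exI[of _ 0] simp: funpow_op_T_zero)

lemma reachable_add:
  assumes "reachable y" "reachable z"
  shows "reachable (y + z)"
  unfolding reachable_def
proof (intro allI impI)
  fix e :: real assume "0 < e"
  then have e: "0 < e / 2" by simp
  obtain K where K: "\<And>k. k \<ge> K \<Longrightarrow> \<exists>x. norm x < e/2 \<and> norm ((op_T ^^ k) x - y) < e/2"
    using reachableD[OF assms(1) e] by blast
  obtain L where L: "\<And>k. k \<ge> L \<Longrightarrow> \<exists>x. norm x < e/2 \<and> norm ((op_T ^^ k) x - z) < e/2"
    using reachableD[OF assms(2) e] by blast
  show "\<exists>K. \<forall>k\<ge>K. \<exists>x. norm x < e \<and> norm ((op_T ^^ k) x - (y + z)) < e"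
  proof (intro exI[of _ "max K L"] allI impI)
    fix k assume "max K L \<le> k"
    then obtain x x' where "norm x < e/2" "norm ((op_T ^^ k) x - y) < e/2"
      "norm x' < e/2" "norm ((op_T ^^ k) x' - z) < e/2"
      using K[of k] L[of k] by auto
    then show "\<exists>x. norm x < e \<and> norm ((op_T ^^ k) x - (y + z)) < e"
      by (intro exI[of _ "x + x'"])
        (auto simp: funpow_op_T_add add_diff_add intro!: norm_add_less[of _ "e/2" _ "e/2", simplified])
  qed
qed

text \<open>A vector that works for \<open>y\<close> at time \<open>k - n\<close> works for the
  image at time \<open>k\<close>; the radius \<open>e / C\<close> absorbs the norm of the
  \<open>n\<close>-th iterate.\<close>

lemma reachable_image:
  assumes "reachable y"
  shows "reachable ((op_T ^^ n) y)"
  unfolding reachable_def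
proof (intro allI impI)
  fix e :: real assume e: "0 < e"
  obtain C where C: "0 < C" "\<And>x. norm ((op_T ^^ n) x) \<le> norm x * C"
    using bounded_linear.pos_bounded[OF funpow_op_T_bounded] by blast
  have "0 < min e (e / C)" using e C by simp
  then obtain K where K: "\<And>k. k \<ge> K \<Longrightarrow> \<exists>x. norm x < min e (e / C) \<and> norm ((op_T ^^ k) x - y) < min e (e / C)"
    using reachableD[OF assms] by blast
  show "\<exists>K. \<forall>k\<ge>K. \<exists>x. norm x < e \<and> norm ((op_T ^^ k) x - (op_T ^^ n) y) < e"
  proof (intro exI[of _ "K + n"] allI impI)
    fix k assume k: "K + n \<le> k"
    then have "K \<le> k - n" by linarith
    then obtain x where x: "norm x < min e (e / C)" "norm ((op_T ^^ (k - n)) x - y) < min e (e / C)"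
      using K by blast
    have "(op_T ^^ k) x = (op_T ^^ n) ((op_T ^^ (k - n)) x)"
      using k funpow_add[of n "k - n" op_T] by simp
    then have "norm ((op_T ^^ k) x - (op_T ^^ n) y) \<le> norm ((op_T ^^ (k - n)) x - y) * C"
      using C(2) by (simp add: funpow_op_T_diff[symmetric])
    also have "\<dots> < e"
      using x(2) C(1) by (simp add: pos_less_divide_eq)
    finally show "\<exists>x. norm x < e \<and> norm ((op_T ^^ k) x - (op_T ^^ n) y) < e"
      using x(1) by auto
  qed
qed

lemma reachable_scale:
  assumes "reachable y"
  shows "reachable (c *\<^sub>C y)"
  unfolding reachable_def
proof (intro allI impI)
  fix e :: real assume e: "0 < e"
  \<comment> \<open>The \<open>+ 1\<close> covers \<open>c = 0\<close>.\<close>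
  define e' where "e' = e / (cmod c + 1)"
  have "0 < cmod c + 1"
    using norm_ge_zero[of c] by linarith
  then have e': "0 < e'" "cmod c * e' < e"
    using e by (auto simp: e'_def pos_divide_less_eq algebra_simps)
  obtain K where K: "\<And>k. k \<ge> K \<Longrightarrow> \<exists>x. norm x < e' \<and> norm ((op_T ^^ k) x - y) < e'"
    using reachableD[OF assms e'(1)] by blast
  have lt: "norm (c *\<^sub>C x) < e" if "norm x < e'" for x
    using e'(2) mult_left_mono[of "norm x" e' "cmod c"] that by (simp add: norm_cscale)
  show "\<exists>K. \<forall>k\<ge>K. \<exists>x. norm x < e \<and> norm ((op_T ^^ k) x - c *\<^sub>C y) < e"
  proof (intro exI[of _ K] allI impI)
    fix k assume "K \<le> k"
    then obtain x where "norm x < e'" "norm ((op_T ^^ k) x - y) < e'"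
      using K by blast
    then show "\<exists>x. norm x < e \<and> norm ((op_T ^^ k) x - c *\<^sub>C y) < e"
      using lt by (intro exI[of _ "c *\<^sub>C x"])
        (simp add: funpow_op_T_scale ell2.scale_right_diff_distrib[symmetric])
  qed
qed

text \<open>For positive \<open>k\<close> the first bound puts the parent below the block; the
  second keeps block numbers polynomial in \<open>k\<close>.\<close>

lemma prod_encode_bounds: "k + l \<le> prod_encode (k, l) - k" "prod_encode (k, l) \<le> (k + l + 1)\<^sup>2"
proof -
  have "n \<le> triangle n" for n
    by (induction n) auto
  then show "k + l \<le> prod_encode (k, l) - k"
    by (simp add: prod_encode_def)
  have "triangle n + n \<le> (n + 1)\<^sup>2" for n
    by (induction n) (auto simp: power2_eq_square)
  from this[of "k + l"] show "prod_encode (k, l) \<le> (k + l + 1)\<^sup>2"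
    by (simp add: prod_encode_def)
qed

text \<open>For fixed \<open>l\<close> the left side of the admissibility condition is bounded by a
  polynomial of degree 6 in \<open>k\<close>, while the right side grows exponentially.\<close>

lemma eventually_attached: "\<forall>\<^sub>F k in sequentially. attached (prod_encode (k, l))"
proof -
  define A where "A = 96 * real (period l) * 2 ^ (l + 1)"
  \<comment> \<open>The exponent \<open>real k / 4 - 1\<close> is a lower bound for
    \<open>k div 4\<close> without rounding.\<close>
  have "(\<lambda>k. A * (real k + real l + 3) ^ 6 / 2 powr (real k / 4 - 1)) \<longlonglongrightarrow> 0"
    by real_asymp
  then have "\<forall>\<^sub>F k in sequentially. A * (real k + real l + 3) ^ 6 / 2 powr (real k / 4 - 1) < 1"
    by (rule order_tendstoD) simp
  then show ?thesis
    using eventually_gt_at_top[of 0]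
  proof eventually_elim
    case (elim k)
    define m where "m = prod_encode (k, l)"
    define Z where "Z = k + l + 3"
    have m: "delay m = k" "parent m = l"
      by (simp_all add: m_def delay_def parent_def)
    have "l < m"
      using prod_encode_bounds(1)[of k l] elim(2) unfolding m_def by linarith
    have mZ: "m + 2 \<le> Z\<^sup>2"
      using prod_encode_bounds(2)[of k l] unfolding m_def Z_def
      by (simp add: power2_eq_square algebra_simps)
    have "3 * k * period l * 2 ^ (l + 1) * (k + 1) * (32 * (m + 1) * (m + 2))
        = (96 * period l * 2 ^ (l + 1)) * (k * (k + 1) * ((m + 1) * (m + 2)))"
      by (simp add: algebra_simps)
    also have "\<dots> \<le> (96 * period l * 2 ^ (l + 1)) * (Z * Z * (Z\<^sup>2 * Z\<^sup>2))"
      using mZ by (intro mult_left_mono mult_mono) (auto simp: Z_def)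
    also have "\<dots> = (96 * period l * 2 ^ (l + 1)) * Z ^ 6"
      by (simp add: power_numeral_reduce algebra_simps)
    finally have "real (3 * k * period l * 2 ^ (l + 1) * (k + 1) * (32 * (m + 1) * (m + 2)))
        \<le> real ((96 * period l * 2 ^ (l + 1)) * Z ^ 6)"
      by (rule of_nat_mono)
    also have "\<dots> = A * (real k + real l + 3) ^ 6"
      by (simp add: A_def Z_def)
    also have "\<dots> \<le> 2 powr (real k / 4 - 1)"
      using elim(1) by (simp add: divide_simps)
    also have "\<dots> \<le> 2 powr real (k div 4)"
      by (intro powr_mono) linarith+
    also have "\<dots> = real (2 ^ (k div 4))"
      by (simp add: powr_realpow)
    finally have "3 * k * period l * 2 ^ (l + 1) * (k + 1) * (32 * (m + 1) * (m + 2)) \<le> 2 ^ (k div 4)"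
      by (rule of_nat_le_iff[THEN iffD1])
    then show ?case
      unfolding m_def[symmetric] attached_def m using \<open>l < m\<close> elim(2) by blast
  qed
qed

text \<open>At time \<open>k\<close> the witness is \<open>orb m 0\<close> for the block coding
  \<open>(k, l)\<close>: the sizes at 0 and \<open>k\<close> are both \<open>1 / (k + 1)\<close>,
  and the gate is closed at 0 and open at \<open>k\<close>.\<close>

lemma reachable_orb_0: "reachable (orb l 0)"
  unfolding reachable_def
proof (intro allI impI)
  fix e :: real assume e: "0 < e"
  have "(\<lambda>k. 1 / (real k + 1)) \<longlonglongrightarrow> 0"
    by real_asymp
  then have "\<forall>\<^sub>F k in sequentially. 1 / (real k + 1) < e"
    using e by (rule order_tendstoD)
  then have "\<forall>\<^sub>F k in sequentially. \<exists>x. norm x < e \<and> norm ((op_T ^^ k) x - orb l 0) < e"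
    using eventually_attached[of l]
  proof eventually_elim
    case (elim k)
    define m where "m = prod_encode (k, l)"
    have m: "delay m = k" "parent m = l"
      by (simp_all add: m_def delay_def parent_def)
    have a: "attached m"
      using elim by (simp add: m_def)
    have c: "cdist (period m) 0 = 0"
      by (simp add: cdist_def)
    have size: "size_at m 0 = 1 / (real k + 1)" "size_at m (int k) = 1 / (real k + 1)"
      using cdist_delay[OF a] by (auto simp: size_at_def depth_def a m c add.commute)
    have "\<not> gate m 0" "gate m (int k)"
      using cdist_delay[OF a] attachedD(2)[OF a]
      by (auto simp: gate_def a m c cdist_minus)
    then have "orb m 0 = complex_of_real (1 / (real k + 1)) *\<^sub>C basis_vec m 0"
      "orb m (int k) - orb l 0 = complex_of_real (1 / (real k + 1)) *\<^sub>C basis_vec m (int k)"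
      by (subst orb.simps, simp add: size m)+
    then have "norm (orb m 0) < e" "norm ((op_T ^^ k) (orb m 0) - orb l 0) < e"
      using elim(1) unfolding funpow_op_T_orb
      by (simp_all add: norm_cscale basis_vec_def norm_unit_vec norm_divide del: of_real_divide)
    then show ?case by blast
  qed
  then show "\<exists>K. \<forall>k\<ge>K. \<exists>x. norm x < e \<and> norm ((op_T ^^ k) x - orb l 0) < e"
    by (simp add: eventually_sequentially)
qed

lemma reachable_all_span:
  assumes "x \<in> all_span"
  shows "reachable x"
  using assms unfolding all_span_def
proof (induction rule: ell2.span_induct_alt)
  case base
  show ?case by (rule reachable_zero)
next
  case (step c x y)
  then obtain m i where x: "x = orb m i" by auto
  have "(op_T ^^ nat (i mod int (period m))) (orb m 0) = orb m i"
    unfolding funpow_op_T_orb using period_pos[of m] by (intro orb_cong) simp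
  then have "reachable x"
    using reachable_image[OF reachable_orb_0] x by metis
  then show ?case
    using step by (intro reachable_add reachable_scale)
qed

lemma funpow_op_T_all_span: "x \<in> all_span \<Longrightarrow> (op_T ^^ n) x \<in> all_span"
  unfolding all_span_def
proof (induction rule: ell2.span_induct_alt)
  case base
  show ?case by (simp add: funpow_op_T_zero ell2.span_zero)
next
  case (step c x y)
  then have "(op_T ^^ n) x \<in> ell2.span {orb m i | m i. True}"
    using funpow_op_T_orb by (intro ell2.span_base) blast
  then show ?case
    using step.IH unfolding funpow_op_T_add funpow_op_T_scale by (intro ell2.span_add ell2.span_scale)
qed

text \<open>To a periodic \<open>u\<close> in \<open>U\<close> a small \<open>x\<close> is added
  whose \<open>k\<close>-th iterate is close to \<open>v - (op_T ^^ k) u\<close>. Periodicity leaves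
  only finitely many such targets, so one threshold serves them all.\<close>

lemma mixing_op_T: "mixing op_T"
  unfolding mixing_def
proof (intro allI impI, elim conjE)
  fix U V :: "ell2 set"
  assume UV: "open U" "U \<noteq> {}" "open V" "V \<noteq> {}"
  obtain u where u: "u \<in> all_span" "u \<in> U"
    using dense_meets_open[OF closure_all_span UV(1,2)] by blast
  obtain v where v: "v \<in> all_span" "v \<in> V"
    using dense_meets_open[OF closure_all_span UV(3,4)] by blast
  obtain eu where eu: "eu > 0" "ball u eu \<subseteq> U"
    using openE[OF UV(1) u(2)] by blast
  obtain ev where ev: "ev > 0" "ball v ev \<subseteq> V"
    using openE[OF UV(3) v(2)] by blast
  define e where "e = min eu ev"
  have e: "0 < e" using eu ev by (simp add: e_def)
  obtain p where p: "p \<ge> 1" "(op_T ^^ p) u = u"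
    using periodic_all_span[OF u(1)] by blast
  have "\<exists>K. \<forall>k\<ge>K. \<exists>x. norm x < e \<and> norm ((op_T ^^ k) x - (v - (op_T ^^ j) u)) < e" for j
  proof -
    have "reachable (v - (op_T ^^ j) u)"
      using u v funpow_op_T_all_span by (intro reachable_all_span) (auto simp: all_span_def intro: ell2.span_diff)
    then show ?thesis
      using e unfolding reachable_def by blast
  qed
  then obtain K where K: "\<And>j k. k \<ge> K j \<Longrightarrow> \<exists>x. norm x < e \<and> norm ((op_T ^^ k) x - (v - (op_T ^^ j) u)) < e"
    by metis
  define M where "M = Max (K ` {..<p})"
  have "k \<in> return_set op_T U V" if k: "k \<ge> M" for k
  proof -
    have "k mod p < p" using p by simp
    then have "K (k mod p) \<le> M"
      unfolding M_def by (intro Max_ge) auto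
    then obtain x where x: "norm x < e" "norm ((op_T ^^ k) x - (v - (op_T ^^ (k mod p)) u)) < e"
      using K[of "k mod p" k] k by auto
    have "u + x \<in> U"
      using x(1) eu(2) by (auto simp: e_def dist_norm subset_iff)
    moreover have "(op_T ^^ k) (u + x) \<in> V"
    proof (rule subsetD[OF ev(2)])
      have "(op_T ^^ k) (u + x) - v = (op_T ^^ k) x - (v - (op_T ^^ (k mod p)) u)"
        by (simp add: funpow_op_T_add funpow_mod_eq[OF p(2)])
      then have "norm ((op_T ^^ k) (u + x) - v) < e"
        using x(2) by (simp only:)
      then show "(op_T ^^ k) (u + x) \<in> ball v ev"
        by (simp add: dist_norm norm_minus_commute[of v] e_def)
    qed
    ultimately show ?thesis
      unfolding return_set_def by blast
  qed
  then have "- return_set op_T U V \<subseteq> {..<M}"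
    by (auto simp: not_less[symmetric])
  then show "finite (- return_set op_T U V)"
    by (rule finite_subset) simp
qed

lemma chaotic_op_T: "chaotic op_T"
proof -
  have "all_span \<subseteq> {x. periodic_point op_T x}"
    using periodic_all_span by (auto simp: periodic_point_def)
  then have "closure {x. periodic_point op_T x} = UNIV"
    using closure_mono closure_all_span by blast
  then show ?thesis
    unfolding chaotic_def using hypercyclic_if_mixing[OF bounded_clinear_op_T mixing_op_T] by blast
qed

section \<open>Failure of d-transitivity\<close>

lemma coord_basis_vec: "coord (basis_vec m i) (code m' j) =
    (if m = m' \<and> i mod int (period m) = j mod int (period m) then 1 else 0)"
  by (auto simp: basis_vec_def coord_unit_vec code_eq_iff)

text \<open>Parents have smaller numbers, so orbit vectors are triangular with respect to blocks: in
  a span of finitely many blocks only the orbits of the top block reach its coordinates.\<close>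

lemma coord_orb_above: "m < m' \<Longrightarrow> coord (orb m i) (code m' j) = 0"
proof (induction m arbitrary: i rule: less_induct)
  case (less m)
  have "coord (if gate m i then orb (parent m) (i - delay m) else 0) (code m' j) = 0"
    using less.IH[of "parent m"] less.prems by (auto simp: gate_def attached_def coord_zero)
  then show ?case
    using less.prems by (subst orb.simps) (simp add: coord_add coord_cscale coord_basis_vec)
qed

lemma coord_orb_same:
  "coord (orb m i) (code m j) = (if i mod int (period m) = j mod int (period m) then size_at m i else 0)"
proof -
  have "coord (if gate m i then orb (parent m) (i - delay m) else 0) (code m j) = 0"
    by (auto simp: gate_def attached_def coord_zero coord_orb_above)
  then show ?thesis
    by (subst orb.simps) (simp add: coord_add coord_cscale coord_basis_vec)
qed

lemma coord_orb_other:
  "m' \<noteq> m \<Longrightarrow> coord (orb m i) (code m' j) =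
    (if gate m i then coord (orb (parent m) (i - delay m)) (code m' j) else 0)"
  by (subst orb.simps) (simp add: coord_add coord_cscale coord_basis_vec coord_zero)

lemma coord_orb_span:
  assumes "x \<in> orb_span N" "N \<le> m"
  shows "coord x (code m j) = 0"
  using assms(1) unfolding orb_span_def
proof (induction rule: ell2.span_induct_alt)
  case base
  show ?case by (simp add: coord_zero)
next
  case (step c x y)
  then show ?case
    using coord_orb_above assms(2) by (auto simp: coord_add coord_cscale)
qed

lemma orb_in_orb_span: "m < N \<Longrightarrow> orb m i \<in> orb_span N"
  unfolding orb_span_def by (rule ell2.span_base) blast

lemma funpow_op_T_orb_span:
  assumes "x \<in> orb_span N"
  shows "(op_T ^^ n) x \<in> orb_span N"
  using assms unfolding orb_span_def
proof (induction rule: ell2.span_induct_alt)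
  case base
  show ?case by (simp add: funpow_op_T_zero ell2.span_zero)
next
  case (step c x y)
  then have "(op_T ^^ n) x \<in> ell2.span {orb m i | m i. m < N}"
    using funpow_op_T_orb by (intro ell2.span_base) blast
  then show ?case
    using step.IH unfolding funpow_op_T_add funpow_op_T_scale by (intro ell2.span_add ell2.span_scale)
qed

lemma all_span_orb_span:
  assumes "x \<in> all_span"
  shows "\<exists>N\<ge>1. x \<in> orb_span N"
  using assms unfolding all_span_def
proof (induction rule: ell2.span_induct_alt)
  case base
  show ?case by (auto simp: orb_span_def ell2.span_zero)
next
  case (step c x y)
  then obtain m i N where x: "x = orb m i" and N: "N \<ge> 1" "y \<in> orb_span N"
    by auto
  have "y \<in> orb_span (max N (Suc m))"
    using N(2) ell2.span_mono[of "{orb m i | m i. m < N}" "{orb m' i | m' i. m' < max N (Suc m)}"]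
    unfolding orb_span_def by fastforce
  moreover have "x \<in> orb_span (max N (Suc m))"
    unfolding x by (rule orb_in_orb_span) simp
  ultimately show ?case
    using N(1) unfolding orb_span_def
    by (intro exI[of _ "max N (Suc m)"]) (auto intro: ell2.span_add ell2.span_scale)
qed

text \<open>Peels off the top block for the descent; reducing positions modulo the period leaves one
  coefficient per position.\<close>

lemma orb_span_Suc_decomp:
  assumes "x \<in> orb_span (Suc N)"
  shows "\<exists>z\<in>orb_span N. \<exists>y. x = z + (\<Sum>i\<in>{0..<int (period N)}. y i *\<^sub>C orb N i)"
  using assms unfolding orb_span_def[of "Suc N"]
proof (induction rule: ell2.span_induct_alt)
  case base
  show ?case
    by (intro bexI[of _ 0] exI[of _ "\<lambda>_. 0"]) (auto simp: orb_span_def ell2.span_zero)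
next
  case (step c x w)
  then obtain m i z y where x: "x = orb m i" "m < Suc N" and z: "z \<in> orb_span N"
    and w: "w = z + (\<Sum>i\<in>{0..<int (period N)}. y i *\<^sub>C orb N i)"
    by auto
  show ?case
  proof (cases "m < N")
    case True
    then have "c *\<^sub>C x + z \<in> orb_span N"
      using z orb_in_orb_span[OF True, of i] unfolding orb_span_def x
      by (intro ell2.span_add ell2.span_scale)
    then show ?thesis
      unfolding w by (intro bexI[of _ "c *\<^sub>C x + z"] exI[of _ y]) (auto simp: add.assoc)
  next
    case False
    then have m: "m = N" using x by simp
    define i0 where "i0 = i mod int (period N)"
    have i0: "i0 \<in> {0..<int (period N)}"
      using period_pos[of N] by (simp add: i0_def)
    have "x = orb N i0"
      unfolding x m i0_def by (rule orb_cong) simp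
    moreover have "(\<Sum>i\<in>{0..<int (period N)}. (y i + (if i = i0 then c else 0)) *\<^sub>C orb N i)
        = (\<Sum>i\<in>{0..<int (period N)}. y i *\<^sub>C orb N i) + c *\<^sub>C orb N i0"
    proof -
      have "(\<Sum>i\<in>{0..<int (period N)}. (if i = i0 then c else 0) *\<^sub>C orb N i)
          = (\<Sum>i\<in>{0..<int (period N)}. if i = i0 then c *\<^sub>C orb N i0 else 0)"
        by (intro sum.cong) auto
      then show ?thesis
        using i0 by (simp add: ell2.scale_left_distrib sum.distrib sum.delta)
    qed
    ultimately show ?thesis
      using z unfolding w
      by (intro bexI[of _ z] exI[of _ "\<lambda>i. y i + (if i = i0 then c else 0)"]) (auto simp: algebra_simps)
  qed
qed

text \<open>
  If all three sizes are below the maximum, each position is within \<open>k div 4\<close> of \<open>0\<close> (gate closed) or of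
  \<open>k\<close> (gate open). When the gates differ, the second difference of the three positions
  is then close to \<open>\<plusminus>k\<close> or \<open>\<plusminus>2k\<close> on the cycle; but it vanishes, and the period is at least \<open>3k\<close>.
\<close>

lemma gate_change_size:
  fixes q :: nat and i :: int
  assumes "attached m" "gate m (i + q) \<noteq> gate m i \<or> gate m (i + int (2 * q)) \<noteq> gate m i"
  shows "\<exists>t::nat\<le>2. size_at m (i + int (t * q)) = max_size m"
proof (rule ccontr)
  assume contr: "\<not> (\<exists>t::nat\<le>2. size_at m (i + int (t * q)) = max_size m)"
  then have ne: "size_at m (i + int (t * q)) \<noteq> max_size m" if "t \<le> 2" for t
    using that by blast
  define r where "r = int (delay m div 4)"
  define k where "k = int (delay m)"
  define D where "D = int (period m)"
  have D: "0 < D" "3 * k \<le> D"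
    using period_pos[of m] attachedD(3)[OF assms(1)] by (auto simp: D_def k_def)
  have r: "1 \<le> r" "4 * r \<le> k"
    using attachedD(5)[OF assms(1)] by (auto simp: r_def k_def)
  have dk: "cdist D k = k" "cdist D (- k) = k"
    using cdist_delay[OF assms(1)] by (auto simp: D_def k_def cdist_minus)
  have d2k: "k \<le> cdist D (2 * k)" "k \<le> cdist D (- 2 * k)"
    using cdist_double_ge[of k D] r D cdist_minus[of D "2 * k"] by auto
  have zone: "\<exists>z. (z = 0 \<or> z = 1) \<and> cdist D (j - z * k) < r \<and> (gate m j \<longleftrightarrow> z = 1)"
    if ne: "size_at m j \<noteq> max_size m" for j
  proof -
    have "cdist D j < r \<or> cdist D (j - k) < r"
      using size_at_eq_max[OF assms(1), of j] ne by (fastforce simp: D_def k_def r_def)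
    moreover have "k \<le> cdist D j + cdist D (j - k)"
      using cdist_diff[OF D(1), of j "j - k"] dk by simp
    moreover have "gate m j \<longleftrightarrow> cdist D (j - k) \<le> r"
      using assms(1) by (simp add: gate_def D_def k_def r_def)
    ultimately show ?thesis
      using r by (cases "cdist D j < r") (auto intro: exI[of _ 0] exI[of _ 1])
  qed
  obtain z0 where z0: "z0 = 0 \<or> z0 = 1" "cdist D (i - z0 * k) < r" "gate m i \<longleftrightarrow> z0 = 1"
    using zone[OF ne[of 0]] by auto
  obtain z1 where z1: "z1 = 0 \<or> z1 = 1" "cdist D (i + q - z1 * k) < r" "gate m (i + q) \<longleftrightarrow> z1 = 1"
    using zone[OF ne[of 1]] by auto
  obtain z2 where z2: "z2 = 0 \<or> z2 = 1" "cdist D (i + 2 * q - z2 * k) < r" "gate m (i + 2 * q) \<longleftrightarrow> z2 = 1"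
    using zone[OF ne[of 2]] by auto
  \<comment> \<open>The second difference of \<open>i\<close>, \<open>i + q\<close>,
    \<open>i + 2 * q\<close> is 0, so \<open>w * k\<close> combines the three offsets with weights
    1, -2, 1 and is less than \<open>4 * r\<close> away from a multiple of \<open>D\<close>. It is 0
    only if the three zones agree.\<close>
  define w where "w = 2 * z1 - z0 - z2"
  let ?a = "i - z0 * k" and ?b = "i + q - z1 * k" and ?c = "i + 2 * q - z2 * k"
  have "w * k = (?a - ?b) + (?c - ?b)"
    by (simp add: w_def algebra_simps)
  then have "cdist D (w * k) \<le> cdist D ?a + cdist D ?b + (cdist D ?c + cdist D ?b)"
    using cdist_add[OF D(1), of "?a - ?b" "?c - ?b"] cdist_diff[OF D(1), of ?a ?b]
      cdist_diff[OF D(1), of ?c ?b] by simp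
  then have "cdist D (w * k) < k"
    using z0(2) z1(2) z2(2) r by linarith
  moreover have "w = 1 \<or> w = - 1 \<or> w = 2 \<or> w = - 2"
    using assms(2) z0(1,3) z1(1,3) z2(1,3) by (auto simp: w_def)
  ultimately show False
    using dk d2k by auto
qed

text \<open>
  The vector \<open>x'\<close> replaces each \<open>orb N i\<close> by its part in the parent block at time \<open>0\<close>; the replacement stays
  correct at the times \<open>q\<close> and \<open>2q\<close> except where the gate changes, and there the coefficients are tiny.
\<close>

lemma descent:
  assumes x: "x \<in> orb_span (Suc N)" and B: "B \<le> 2"
    and bd: "\<And>t n. t \<le> 2 \<Longrightarrow> cmod (coord ((op_T ^^ (t * q)) x) n) \<le> B"
  shows "\<exists>x'\<in>orb_span N. \<forall>t\<le>2. \<forall>m j. m < N \<longrightarrow>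
    cmod (coord ((op_T ^^ (t * q)) x) (code m j) - coord ((op_T ^^ (t * q)) x') (code m j)) \<le> 2 * err N"
proof -
  define I where "I = {0..<int (period N)}"
  obtain z y where z: "z \<in> orb_span N" and xz: "x = z + (\<Sum>i\<in>I. y i *\<^sub>C orb N i)"
    using orb_span_Suc_decomp[OF x] by (auto simp: I_def)
  define p where "p = (\<lambda>i::int. orb (parent N) (i - delay N))"
  define x' where "x' = z + (\<Sum>i\<in>I. y i *\<^sub>C (if gate N i then p i else 0))"
  have x': "x' \<in> orb_span N"
    unfolding x'_def orb_span_def
  proof (intro ell2.span_add ell2.span_sum ell2.span_scale)
    show "z \<in> ell2.span {orb m i | m i. m < N}"
      using z by (simp add: orb_span_def)
    show "(if gate N i then p i else 0) \<in> ell2.span {orb m i | m i. m < N}" for i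
      using orb_in_orb_span[of "parent N" N] unfolding orb_span_def p_def
      by (auto simp: gate_def attached_def ell2.span_zero)
  qed
  have Tx: "(op_T ^^ n) x = (op_T ^^ n) z + (\<Sum>i\<in>I. y i *\<^sub>C orb N (i + int n))" for n
    by (simp add: xz funpow_op_T_add funpow_op_T_sum funpow_op_T_scale funpow_op_T_orb)
  have Tx': "(op_T ^^ n) x' = (op_T ^^ n) z
      + (\<Sum>i\<in>I. y i *\<^sub>C (if gate N i then p (i + int n) else 0))" for n
  proof -
    have "(op_T ^^ n) (if gate N i then p i else 0) = (if gate N i then p (i + int n) else 0)" for i
      by (simp add: funpow_op_T_zero p_def funpow_op_T_orb algebra_simps)
    then show ?thesis
      by (simp add: x'_def funpow_op_T_add funpow_op_T_sum funpow_op_T_scale)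
  qed
  \<comment> \<open>At time \<open>t * q\<close> the position \<open>i + t * q\<close> of block
    \<open>N\<close> sees only \<open>y i\<close>, because \<open>z\<close> lies in lower blocks and
    distinct positions stay distinct.\<close>
  have ysize: "cmod (y i) * size_at N (i + int (t * q)) \<le> 2" if "i \<in> I" "t \<le> 2" for i t
  proof -
    let ?n = "int (t * q)"
    have inj: "(j + ?n) mod int (period N) = (i + ?n) mod int (period N) \<longleftrightarrow> j = i" if "j \<in> I" for j
    proof
      assume "(j + ?n) mod int (period N) = (i + ?n) mod int (period N)"
      from mod_diff_cong[OF this refl, of ?n] show "j = i"
        using \<open>i \<in> I\<close> that by (simp add: I_def)
    qed simp
    have "coord ((op_T ^^ (t * q)) x) (code N (i + ?n))
        = (\<Sum>j\<in>I. y j * (if j = i then size_at N (i + ?n) else 0))"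
      unfolding Tx coord_add coord_sum coord_cscale coord_orb_same
        coord_orb_span[OF funpow_op_T_orb_span[OF z] order_refl]
      using inj by (auto intro!: sum.cong)
    also have "\<dots> = y i * size_at N (i + ?n)"
      using \<open>i \<in> I\<close> by (simp add: I_def if_distrib cong: if_cong)
    finally have "cmod (y i) * size_at N (i + ?n) \<le> B"
      using bd[OF \<open>t \<le> 2\<close>, of "code N (i + ?n)"] size_at_pos[of N "i + ?n"]
      by (simp add: norm_mult)
    then show ?thesis using B by simp
  qed
  have "cmod (coord ((op_T ^^ (t * q)) x) (code m j) - coord ((op_T ^^ (t * q)) x') (code m j)) \<le> 2 * err N"
    if t: "t \<le> 2" and m: "m < N" for t m j
  proof -
    let ?n = "int (t * q)"
    let ?c = "\<lambda>v. coord v (code m j)"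
    have term_le: "cmod (?c (y i *\<^sub>C orb N (i + ?n)) - ?c (y i *\<^sub>C (if gate N i then p (i + ?n) else 0)))
        \<le> 2 * err N / period N" if i: "i \<in> I" for i
    proof (cases "gate N (i + ?n) = gate N i")
      case True
      then have "?c (orb N (i + ?n)) = ?c (if gate N i then p (i + ?n) else 0)"
        using m by (simp add: coord_orb_other p_def coord_zero)
      then show ?thesis
        using err_nonneg[of N] by (simp add: coord_cscale)
    next
      case False
      then have a: "attached N" by (auto simp: gate_def)
      have "t = 1 \<or> t = 2" using False t by (cases "t = 0") auto
      then have "gate N (i + int q) \<noteq> gate N i \<or> gate N (i + int (2 * q)) \<noteq> gate N i"
        using False by auto
      \<comment> \<open>The time \<open>s\<close> of maximal size may differ from \<open>t\<close>;
        it serves to bound \<open>y i\<close>, which does not depend on time.\<close>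
      then obtain s where "s \<le> 2" "size_at N (i + int (s * q)) = max_size N"
        using gate_change_size[OF a] by blast
      then have y: "cmod (y i) \<le> 2 / max_size N"
        using ysize[OF i, of s] max_size_pos[of N] by (simp add: pos_le_divide_eq)
      have "cmod (?c (y i *\<^sub>C orb N (i + ?n)) - ?c (y i *\<^sub>C (if gate N i then p (i + ?n) else 0)))
          = cmod (y i) * cmod (?c (p (i + ?n)))"
      proof -
        have "?c (orb N (i + ?n)) = (if gate N (i + ?n) then ?c (p (i + ?n)) else 0)"
          using m by (simp add: coord_orb_other p_def)
        then show ?thesis
          using False by (cases "gate N i") (simp_all add: coord_cscale coord_zero norm_mult)
      qed
      also have "\<dots> \<le> (2 / max_size N) * 2 ^ (parent N + 1)"
        using y max_size_pos[of N] cmod_coord_le_norm[of "p (i + ?n)" "code m j"] norm_orb_le[of "parent N"]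
        by (intro mult_mono) (auto simp: p_def intro: order_trans)
      also have "\<dots> = 2 * err N / period N"
        using a period_pos[of N] by (simp add: err_def)
      finally show ?thesis .
    qed
    have "?c ((op_T ^^ (t * q)) x) - ?c ((op_T ^^ (t * q)) x')
        = (\<Sum>i\<in>I. ?c (y i *\<^sub>C orb N (i + ?n)) - ?c (y i *\<^sub>C (if gate N i then p (i + ?n) else 0)))"
      by (simp add: Tx Tx' coord_add coord_sum sum_subtractf)
    also have "cmod \<dots> \<le> (\<Sum>i\<in>I. 2 * err N / period N)"
      by (intro order_trans[OF norm_sum] sum_mono term_le)
    also have "\<dots> = 2 * err N"
      using period_pos[of N] by (simp add: I_def)
    finally show ?thesis .
  qed
  then show ?thesis using x' by blast
qed

text \<open>Removing block \<open>N\<close> costs \<open>2 * err N\<close> in each lower coordinate.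
  The bound assumed for \<open>N\<close> is weaker than that for \<open>Suc N\<close> by just this
  amount, and the conclusion collects the cost at the times 0 and \<open>q\<close>. In the end only
  the fixed block 0 remains.\<close>

lemma root_coord_almost_constant:
  assumes "N \<ge> 1" "x \<in> orb_span N"
    and "\<And>t n. t \<le> 2 \<Longrightarrow> cmod (coord ((op_T ^^ (t * q)) x) n) \<le> 2 - 2 * (\<Sum>m<N. err m)"
  shows "cmod (coord ((op_T ^^ q) x) (code 0 0) - coord x (code 0 0)) \<le> 4 * (\<Sum>m<N. err m)"
  using assms
proof (induction N arbitrary: x rule: nat_induct_at_least)
  case base
  have "(op_T ^^ q) x = x"
    using base(1) unfolding orb_span_def
  proof (induction rule: ell2.span_induct_alt)
    case base
    show ?case by (simp add: funpow_op_T_zero)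
  next
    case (step c x y)
    \<comment> \<open>No parent lies below block 0, so it is not attached and its cycle has one
      position.\<close>
    have "period 0 = 1"
      by (subst period_eq) (simp add: attached_def)
    then have "orb 0 (i + int q) = orb 0 i" for i
      by (intro orb_cong) simp
    then show ?case
      using step by (auto simp: funpow_op_T_add funpow_op_T_scale funpow_op_T_orb)
  qed
  then show ?case
    using err_nonneg by (simp add: sum_nonneg)
next
  case (Suc N)
  have B: "2 - 2 * (\<Sum>m<Suc N. err m) \<le> 2"
    using err_nonneg by (simp add: sum_nonneg del: sum.lessThan_Suc)
  obtain x' where x': "x' \<in> orb_span N" and
    d: "\<And>t m j. t \<le> 2 \<Longrightarrow> m < N \<Longrightarrow>
      cmod (coord ((op_T ^^ (t * q)) x) (code m j) - coord ((op_T ^^ (t * q)) x') (code m j)) \<le> 2 * err N"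
    using descent[OF Suc.prems(1) B Suc.prems(2)] by blast
  have "cmod (coord ((op_T ^^ (t * q)) x') n) \<le> 2 - 2 * (\<Sum>m<N. err m)" if t: "t \<le> 2" for t n
  proof -
    obtain m j where n: "n = code m j" using code_surj by blast
    show ?thesis
    proof (cases "m < N")
      case True
      have "cmod (coord ((op_T ^^ (t * q)) x') n) \<le> (2 - 2 * (\<Sum>m<Suc N. err m)) + 2 * err N"
        using d[OF t True, of j] Suc.prems(2)[OF t, of n]
          norm_triangle_sub[of "coord ((op_T ^^ (t * q)) x') n" "coord ((op_T ^^ (t * q)) x) n"]
        unfolding n by (simp add: norm_minus_commute)
      then show ?thesis by simp
    next
      case False
      then show ?thesis
        using coord_orb_span[OF funpow_op_T_orb_span[OF x'], of m "t * q" j] sum_err_le[of N]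
        by (simp add: n)
    qed
  qed
  then have IH: "cmod (coord ((op_T ^^ q) x') (code 0 0) - coord x' (code 0 0)) \<le> 4 * (\<Sum>m<N. err m)"
    by (rule Suc.IH[OF x'])
  have "0 < N" using Suc.hyps by simp
  have tri: "cmod (a - b) \<le> cmod (a - a') + cmod (b - b') + cmod (a' - b')" for a b a' b'
  proof -
    have "a - b = (a - a') - (b - b') + (a' - b')" by simp
    also have "cmod \<dots> \<le> cmod ((a - a') - (b - b')) + cmod (a' - b')"
      by (rule norm_triangle_ineq)
    finally show ?thesis
      using norm_triangle_ineq4[of "a - a'" "b - b'"] by linarith
  qed
  have d0: "cmod (coord x (code 0 0) - coord x' (code 0 0)) \<le> 2 * err N"
    using d[of 0 0 0] \<open>0 < N\<close> by simp
  have d1: "cmod (coord ((op_T ^^ q) x) (code 0 0) - coord ((op_T ^^ q) x') (code 0 0)) \<le> 2 * err N"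
    using d[of 1 0 0] \<open>0 < N\<close> by simp
  have "cmod (coord ((op_T ^^ q) x) (code 0 0) - coord x (code 0 0))
      \<le> 2 * err N + 2 * err N + 4 * (\<Sum>m<N. err m)"
    by (rule order_trans[OF tri add_mono[OF add_mono[OF d1 d0] IH]])
  then show ?case
    by simp
qed

text \<open>The coordinate at block 0 has modulus at most 1 / 8 on \<open>U0\<close> and is within 1
  / 8 of 1 / 2 on \<open>U1\<close>, but from time 0 to \<open>k\<close> it moves by at most
  \<open>4 / 32 = 1 / 8\<close>, and three eighths do not reach 1 / 2. The ball \<open>U2\<close>
  supplies the bound at time \<open>2 * k\<close>.\<close>

lemma not_d_transitive_op_T: "\<not> d_transitive [op_T, op_T ^^ 2]"
proof
  assume dt: "d_transitive [op_T, op_T ^^ 2]"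
  define b where "b = (1 / 2) *\<^sub>R basis_vec 0 0"
  define U0 where "U0 = ball (0::ell2) (1 / 8)"
  define U1 where "U1 = ball b (1 / 8)"
  define U2 where "U2 = ball (0::ell2) 1"
  have "{k. (\<Inter>i<length [op_T, op_T ^^ 2]. (([op_T, op_T ^^ 2] ! i) ^^ k) -` ([U1, U2] ! i)) \<inter> U0 \<noteq> {}} \<noteq> {}"
    by (rule dt[unfolded d_transitive_def, rule_format]) (auto simp: U0_def U1_def U2_def)
  then obtain k x0 where x0: "(op_T ^^ k) x0 \<in> U1" "((op_T ^^ 2) ^^ k) x0 \<in> U2" "x0 \<in> U0"
    by (auto simp: lessThan_Suc)
  \<comment> \<open>The estimates concern spans of finitely many blocks, so \<open>x0\<close> is
    replaced by a vector of \<open>all_span\<close> in the open set of vectors that visit the same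
    three balls.\<close>
  define W where "W = (op_T ^^ k) -` U1 \<inter> (op_T ^^ (2 * k)) -` U2 \<inter> U0"
  have "open ((op_T ^^ n) -` ball a e)" for n a e
    using funpow_op_T_bounded by (intro open_vimage) (auto intro: linear_continuous_on)
  then have "open W"
    unfolding W_def U0_def U1_def U2_def by (intro open_Int open_ball)
  moreover have "x0 \<in> W"
    using x0 by (simp add: W_def funpow_mult)
  ultimately obtain x where x: "x \<in> all_span" "x \<in> W"
    using dense_meets_open[OF closure_all_span] by blast
  obtain N where N: "N \<ge> 1" "x \<in> orb_span N"
    using all_span_orb_span[OF x(1)] by blast
  have nb: "norm b = 1 / 2"
    by (simp add: b_def basis_vec_def norm_unit_vec)
  have n0: "norm x < 1 / 8" and n1: "norm ((op_T ^^ k) x - b) < 1 / 8"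
    and n2: "norm ((op_T ^^ (2 * k)) x) < 1"
    using x(2) by (auto simp: W_def U0_def U1_def U2_def dist_norm norm_minus_commute)
  have "norm ((op_T ^^ k) x) < 1"
    using n1 nb norm_triangle_ineq[of "(op_T ^^ k) x - b" b] by simp
  then have "norm ((op_T ^^ (t * k)) x) \<le> 1" if "t \<le> 2" for t
    using that n0 n2 by (cases "t = 0 \<or> t = 1") (auto simp: le_Suc_eq numeral_2_eq_2)
  then have "cmod (coord ((op_T ^^ (t * k)) x) n) \<le> 2 - 2 * (\<Sum>m<N. err m)" if "t \<le> 2" for t n
    using that cmod_coord_le_norm[of "(op_T ^^ (t * k)) x" n] sum_err_le[of N] by fastforce
  then have "cmod (coord ((op_T ^^ k) x) (code 0 0) - coord x (code 0 0)) \<le> 4 * (\<Sum>m<N. err m)"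
    by (rule root_coord_almost_constant[OF N])
  then have small: "cmod (coord ((op_T ^^ k) x) (code 0 0) - coord x (code 0 0)) \<le> 1 / 8"
    using sum_err_le[of N] by linarith
  have b: "coord b (code 0 0) = 1 / 2"
    by (simp add: b_def scaleR_eq_cscale coord_cscale coord_basis_vec)
  have "cmod (coord ((op_T ^^ k) x) (code 0 0) - 1 / 2) < 1 / 8"
    unfolding b[symmetric] coord_diff[symmetric]
    by (rule order_le_less_trans[OF cmod_coord_le_norm n1])
  then have close: "cmod (coord ((op_T ^^ k) x) (code 0 0) - 1 / 2) \<le> 1 / 8"
    by (rule less_imp_le)
  have x0: "cmod (coord x (code 0 0)) \<le> 1 / 8"
    using cmod_coord_le_norm[of x "code 0 0"] n0 by simp
  have tri: "cmod (1 / 2) \<le> cmod (a - c) + cmod (a - 1 / 2) + cmod c" for a c :: complex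
  proof -
    have "1 / 2 = (a - c) - (a - 1 / 2) + c" by simp
    also have "cmod \<dots> \<le> cmod ((a - c) - (a - 1 / 2)) + cmod c"
      by (rule norm_triangle_ineq)
    finally show ?thesis
      using norm_triangle_ineq4[of "a - c" "a - 1 / 2"] by linarith
  qed
  have "cmod (1 / 2) \<le> 1 / 8 + 1 / 8 + 1 / 8"
    by (rule order_trans[OF tri add_mono[OF add_mono[OF small close] x0]])
  then show False
    by (simp add: norm_divide)
qed

theorem theorem1p6:
  shows "\<exists>T :: ell2 \<Rightarrow> ell2.
    bounded_clinear T \<and> mixing T \<and> chaotic T \<and> \<not> d_transitive [T, T ^^ 2]"
  using bounded_clinear_op_T mixing_op_T chaotic_op_T not_d_transitive_op_T by blast

end
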